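(* Let $k\ge2$ and $\mathbb{P}^2_k=\mathbb{P}(1,1,k)$. If $d\ge 2k+1$, a generic foliation with normal $\mathbb{Q}$-bundle of degree $d$ on $\mathbb{P}^2_k$ does not admit any invariant algebraic curve (the set of $\mathcal{F}\in\mathsf{Fol}(d)$ admitting an invariant algebraic curve is contained in a countable union of proper Zariski-closed subsets of $\mathsf{Fol}(d)$). Moreover, if $d<2k+1$, every foliation in $\mathsf{Fol}(d)$ admits some invariant algebraic curve.
   Context: $\mathbb{P}(1,1,k)$ is the quotient of $\mathbb{C}^3\setminus\{0\}$ by $t\cdot(x_0,x_1,x_2)=(tx_0,tx_1,t^{k}x_2)$. A polynomial is quasi-homogeneous of degree $n$ if it is a linear combination of monomials $x_0^ax_1^bx_2^c$ with $a+b+kc=n$. Let $R=x_0\partial_{x_0}+x_1\partial_{x_1}+kx_2\partial_{x_2}$. $\mathsf{Fol}(d)$ is the projectivization of the space of polynomial 1-forms $\omega=A_0dx_0+A_1dx_1+A_2dx_2$ with $A_0,A_1$ quasi-homogeneous of degree $d-1$, $A_2$ quasi-homogeneous of degree $d-k$, and $i_R\omega=0$; its elements are the foliations with normal $\mathbb{Q}$-bundle of degree $d$. An algebraic curve is the zero set of a nonconstant quasi-homogeneous polynomial $F$; it is invariant by $[\omega]$ if $\omega\wedge dF=F\Theta$ for some polynomial 2-form $\Theta$. *)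

theory Defs
  imports Main "HOL.Complex"
begin

text \<open>Polynomials in C[x0,x1,x2] are represented by their coefficient functions on
exponent triples (a,b,c) (monomial x0^a x1^b x2^c), required to have finite support.\<close>

type_synonym mon = "nat \<times> nat \<times> nat"
type_synonym cpoly = "mon \<Rightarrow> complex"

definition is_poly :: "cpoly \<Rightarrow> bool" where
  "is_poly p \<longleftrightarrow> finite {m. p m \<noteq> 0}"

definition qdeg :: "nat \<Rightarrow> mon \<Rightarrow> int" where
  "qdeg k m = (case m of (a,b,c) \<Rightarrow> int a + int b + int k * int c)"

text \<open>quasi-homogeneous of degree n (the zero polynomial included); n may be negative,
in which case only the zero polynomial qualifies\<close>
definition quasi_hom :: "nat \<Rightarrow> int \<Rightarrow> cpoly \<Rightarrow> bool" where
  "quasi_hom k n p \<longleftrightarrow> is_poly p \<and> (\<forall>m. p m \<noteq> 0 \<longrightarrow> qdeg k m = n)"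

definition pmult :: "cpoly \<Rightarrow> cpoly \<Rightarrow> cpoly" where
  "pmult p q = (\<lambda>(a,b,c). \<Sum>i\<le>a. \<Sum>j\<le>b. \<Sum>l\<le>c. p (i,j,l) * q (a-i, b-j, c-l))"

definition padd :: "cpoly \<Rightarrow> cpoly \<Rightarrow> cpoly" where
  "padd p q = (\<lambda>m. p m + q m)"

definition psub :: "cpoly \<Rightarrow> cpoly \<Rightarrow> cpoly" where
  "psub p q = (\<lambda>m. p m - q m)"

definition pconst :: "complex \<Rightarrow> cpoly" where
  "pconst c = (\<lambda>m. if m = (0,0,0) then c else 0)"

definition var0 :: cpoly where "var0 = (\<lambda>m. if m = (1,0,0) then 1 else 0)"
definition var1 :: cpoly where "var1 = (\<lambda>m. if m = (0,1,0) then 1 else 0)"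
definition var2 :: cpoly where "var2 = (\<lambda>m. if m = (0,0,1) then 1 else 0)"

definition d0 :: "cpoly \<Rightarrow> cpoly" where
  "d0 p = (\<lambda>(a,b,c). of_nat (Suc a) * p (Suc a, b, c))"
definition d1 :: "cpoly \<Rightarrow> cpoly" where
  "d1 p = (\<lambda>(a,b,c). of_nat (Suc b) * p (a, Suc b, c))"
definition d2 :: "cpoly \<Rightarrow> cpoly" where
  "d2 p = (\<lambda>(a,b,c). of_nat (Suc c) * p (a, b, Suc c))"

text \<open>A polynomial 1-form A0 dx0 + A1 dx1 + A2 dx2 is the triple (A0, A1, A2).\<close>
type_synonym form1 = "cpoly \<times> cpoly \<times> cpoly"

definition form_smult :: "complex \<Rightarrow> form1 \<Rightarrow> form1" where
  "form_smult t w = (case w of (A0,A1,A2) \<Rightarrow>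
     ((\<lambda>m. t * A0 m), (\<lambda>m. t * A1 m), (\<lambda>m. t * A2 m)))"

text \<open>contraction with R = x0 d/dx0 + x1 d/dx1 + k x2 d/dx2\<close>
definition contract_R :: "nat \<Rightarrow> form1 \<Rightarrow> cpoly" where
  "contract_R k w = (case w of (A0,A1,A2) \<Rightarrow>
     padd (padd (pmult var0 A0) (pmult var1 A1)) (pmult (pconst (of_nat k)) (pmult var2 A2)))"

text \<open>The vector space whose projectivization is Fol(d).\<close>
definition FolSpace :: "nat \<Rightarrow> nat \<Rightarrow> form1 set" where
  "FolSpace k d = {(A0,A1,A2). quasi_hom k (int d - 1) A0 \<and> quasi_hom k (int d - 1) A1
      \<and> quasi_hom k (int d - int k) A2 \<and> contract_R k (A0,A1,A2) = (\<lambda>m. 0)}"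

text \<open>Foliations in Fol(d): nonzero elements of FolSpace (each representing its class
in the projectivization; all notions below are invariant under nonzero scaling).\<close>
definition Fol :: "nat \<Rightarrow> nat \<Rightarrow> form1 set" where
  "Fol k d = FolSpace k d - {((\<lambda>m. 0), (\<lambda>m. 0), (\<lambda>m. 0))}"

text \<open>w /\ dF = F Theta, with Theta = T01 dx0/\dx1 + T02 dx0/\dx2 + T12 dx1/\dx2 polynomial.\<close>
definition invariant_curve :: "form1 \<Rightarrow> cpoly \<Rightarrow> bool" where
  "invariant_curve w F \<longleftrightarrow> (case w of (A0,A1,A2) \<Rightarrow>
     (\<exists>T01 T02 T12. is_poly T01 \<and> is_poly T02 \<and> is_poly T12 \<and>
        psub (pmult A0 (d1 F)) (pmult A1 (d0 F)) = pmult F T01 \<and>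
        psub (pmult A0 (d2 F)) (pmult A2 (d0 F)) = pmult F T02 \<and>
        psub (pmult A1 (d2 F)) (pmult A2 (d1 F)) = pmult F T12))"

definition alg_curve_poly :: "nat \<Rightarrow> cpoly \<Rightarrow> bool" where
  "alg_curve_poly k F \<longleftrightarrow> (\<exists>n. quasi_hom k n F) \<and> (\<exists>m. m \<noteq> (0,0,0) \<and> F m \<noteq> 0)"

definition has_invariant_curve :: "nat \<Rightarrow> form1 \<Rightarrow> bool" where
  "has_invariant_curve k w \<longleftrightarrow> (\<exists>F. alg_curve_poly k F \<and> invariant_curve w F)"

definition form_coeff :: "nat \<Rightarrow> mon \<Rightarrow> form1 \<Rightarrow> complex" where
  "form_coeff i m w = (case w of (A0,A1,A2) \<Rightarrow>
     (if i = 0 then A0 m else if i = 1 then A1 m else A2 m))"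

inductive_set poly_fun :: "(form1 \<Rightarrow> complex) set" where
  pf_const: "(\<lambda>w. c) \<in> poly_fun"
| pf_coord: "form_coeff i m \<in> poly_fun"
| pf_add: "f \<in> poly_fun \<Longrightarrow> g \<in> poly_fun \<Longrightarrow> (\<lambda>w. f w + g w) \<in> poly_fun"
| pf_mult: "f \<in> poly_fun \<Longrightarrow> g \<in> poly_fun \<Longrightarrow> (\<lambda>w. f w * g w) \<in> poly_fun"

definition hom_poly_fun :: "(form1 \<Rightarrow> complex) \<Rightarrow> bool" where
  "hom_poly_fun f \<longleftrightarrow> f \<in> poly_fun \<and>
     (\<exists>e::nat. \<forall>t w. f (form_smult t w) = t ^ e * f w)"

definition zariski_closed_in_Fol :: "nat \<Rightarrow> nat \<Rightarrow> (form1 \<Rightarrow> complex) set \<Rightarrow> form1 set" where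
  "zariski_closed_in_Fol k d S = {w \<in> Fol k d. \<forall>f\<in>S. f w = 0}"

end

theory Submission
  imports Defs "HOL-Computational_Algebra.Polynomial"
    "HOL-Computational_Algebra.Fundamental_Theorem_Algebra" "HOL-Library.Countable"
begin

text \<open>
  For \<open>d \<le> 2k\<close> the coefficient \<open>A2\<close> of \<open>dx2\<close> does not involve \<open>x2\<close>, so it is zero or a binary form in
  \<open>x0\<close>, \<open>x1\<close>; then \<open>x0\<close>, or a linear factor of \<open>A2\<close>, is invariant.

  Let \<open>d \<ge> 2k + 1\<close>. In the chart \<open>x0 = 1\<close> a form is a derivation of \<open>\<complex>[x, y]\<close>. Consider the pencil
  through \<open>\<omega>\<^sub>0\<close>, given by Shamsuddin's derivation \<open>\<partial>\<^sub>x + (x\<^sup>m y + 1)\<partial>\<^sub>y\<close>, whose only invariant curve is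
  the line \<open>x0 = 0\<close>, and a form \<open>\<omega>\<^sub>1\<close> that does not preserve this line. Write a form \<open>\<omega>\<close> that satisfies no
  rational algebraic relation except those valid on all of \<open>Fol(d)\<close> as \<open>q (\<omega>\<^sub>0 + t z)\<close>, with \<open>t\<close> the
  coordinate along \<open>\<omega>\<^sub>1\<close>. Then \<open>t\<close> is not invertible in the ring generated over the rationals by \<open>t\<close> and the
  coefficients of \<open>z\<close>, so there is a valuation ring of \<open>\<complex>\<close> that contains this ring and has \<open>t\<close> in its
  maximal ideal. Modulo that ideal an invariant curve of \<open>\<omega>\<close> becomes one of \<open>\<omega>\<^sub>0\<close>, hence a
  multiple of \<open>x0 = 0\<close>. Comparing the valuations of \<open>t\<close> and of the terms of positive degree in \<open>y\<close> of the
  curve and of its cofactor then gives a contradiction.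
\<close>

section \<open>Valuation rings\<close>

definition subring_set :: "'a::comm_ring_1 set \<Rightarrow> bool" where
  "subring_set B \<longleftrightarrow> 1 \<in> B \<and> (\<forall>x\<in>B. \<forall>y\<in>B. x - y \<in> B \<and> x * y \<in> B)"

lemma
  assumes "subring_set B"
  shows subring_set_1: "1 \<in> B"
    and subring_set_diff: "x \<in> B \<Longrightarrow> y \<in> B \<Longrightarrow> x - y \<in> B"
    and subring_set_mult: "x \<in> B \<Longrightarrow> y \<in> B \<Longrightarrow> x * y \<in> B"
    and subring_set_0: "0 \<in> B"
    and subring_set_add: "x \<in> B \<Longrightarrow> y \<in> B \<Longrightarrow> x + y \<in> B"
proof -
  show "1 \<in> B"
    using assms by (simp add: subring_set_def)
  show d: "x - y \<in> B" if "x \<in> B" "y \<in> B" for x y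
    using assms that by (simp add: subring_set_def)
  show "x * y \<in> B" if "x \<in> B" "y \<in> B"
    using assms that by (simp add: subring_set_def)
  show 0: "0 \<in> B"
    using d[OF \<open>1 \<in> B\<close> \<open>1 \<in> B\<close>] by simp
  show "x + y \<in> B" if "x \<in> B" "y \<in> B"
    using d[OF that(1) d[OF 0 that(2)]] by simp
qed

lemma subring_set_sum:
  assumes "subring_set B" "\<And>i. i \<in> I \<Longrightarrow> f i \<in> B"
  shows "sum f I \<in> B"
  using assms(2) by (induction I rule: infinite_finite_induct)
    (auto intro: subring_set_0 subring_set_add assms(1))

lemma subring_set_power:
  assumes "subring_set B" "x \<in> B"
  shows "x ^ n \<in> B"
  by (induction n) (auto intro: subring_set_1 subring_set_mult assms)

definition poly_over :: "'a::comm_ring_1 set \<Rightarrow> 'a poly \<Rightarrow> bool" where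
  "poly_over B p \<longleftrightarrow> (\<forall>i. coeff p i \<in> B)"

lemma poly_over_diff:
  "subring_set B \<Longrightarrow> poly_over B p \<Longrightarrow> poly_over B q \<Longrightarrow> poly_over B (p - q)"
  by (simp add: poly_over_def subring_set_diff)

lemma poly_over_add:
  "subring_set B \<Longrightarrow> poly_over B p \<Longrightarrow> poly_over B q \<Longrightarrow> poly_over B (p + q)"
  by (simp add: poly_over_def subring_set_add)

lemma poly_over_mult:
  "subring_set B \<Longrightarrow> poly_over B p \<Longrightarrow> poly_over B q \<Longrightarrow> poly_over B (p * q)"
  by (simp add: poly_over_def coeff_mult subring_set_sum subring_set_mult)

lemma poly_over_monom:
  "subring_set B \<Longrightarrow> c \<in> B \<Longrightarrow> poly_over B (monom c n)"
  by (simp add: poly_over_def subring_set_0)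

lemma poly_over_reflect:
  "subring_set B \<Longrightarrow> poly_over B p \<Longrightarrow> poly_over B (reflect_poly p)"
  by (simp add: poly_over_def coeff_reflect_poly subring_set_0)

lemma poly_in_subring:
  "subring_set B \<Longrightarrow> poly_over B p \<Longrightarrow> z \<in> B \<Longrightarrow> poly p z \<in> B"
  unfolding poly_altdef poly_over_def
  by (intro subring_set_sum subring_set_mult subring_set_power) auto

definition adjoin :: "'a::comm_ring_1 set \<Rightarrow> 'a \<Rightarrow> 'a set" where
  "adjoin B z = {poly p z | p. poly_over B p}"

lemma adjoinI: "poly_over B p \<Longrightarrow> poly p z \<in> adjoin B z"
  by (auto simp: adjoin_def)

lemma subring_set_adjoin:
  assumes B: "subring_set B"
  shows "subring_set (adjoin B z)"
proof -
  have "1 \<in> adjoin B z"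
    using adjoinI[OF poly_over_monom[OF B subring_set_1[OF B], of 0], of z]
    by (simp add: poly_monom)
  moreover have "x - y \<in> adjoin B z \<and> x * y \<in> adjoin B z"
    if xy: "x \<in> adjoin B z" "y \<in> adjoin B z" for x y
  proof -
    obtain p q where "x = poly p z" "poly_over B p" "y = poly q z" "poly_over B q"
      using xy unfolding adjoin_def by blast
    then show ?thesis
      using adjoinI[OF poly_over_diff[OF B], of p q z] adjoinI[OF poly_over_mult[OF B], of p q z]
      by simp
  qed
  ultimately show ?thesis
    by (simp add: subring_set_def)
qed

lemma subset_adjoin:
  assumes "subring_set B"
  shows "B \<subseteq> adjoin B z"
proof
  fix b assume "b \<in> B"
  then show "b \<in> adjoin B z"
    using adjoinI[OF poly_over_monom[OF assms, of b 0], of z] by (simp add: poly_monom)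
qed

lemma self_in_adjoin:
  assumes "subring_set B"
  shows "z \<in> adjoin B z"
  using adjoinI[OF poly_over_monom[OF assms subring_set_1[OF assms], of 1], of z]
  by (simp add: poly_monom)

text \<open>Among the subrings in which \<open>x\<close> is not invertible, a maximal one is a valuation ring:
  if neither \<open>z\<close> nor \<open>1/z\<close> belonged to it, then \<open>x\<close> would become invertible after adjoining
  either of them, and the two resulting relations could be played against each other to lower
  the degree of the longer one.\<close>

locale maximal_noninvertible =
  fixes B :: "'a::field set" and x :: 'a
  assumes B: "subring_set B"
    and xB: "x \<in> B"
    and noninv: "b \<in> B \<Longrightarrow> x * b \<noteq> 1"
    and maximal: "subring_set C \<Longrightarrow> B \<subseteq> C \<Longrightarrow> \<forall>c\<in>C. x * c \<noteq> 1 \<Longrightarrow> C = B"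
begin

lemma relation:
  assumes "z \<notin> B"
  shows "\<exists>p. poly_over B p \<and> x * poly p z = 1"
proof (rule ccontr)
  assume "\<not> ?thesis"
  then have "\<forall>c\<in>adjoin B z. x * c \<noteq> 1"
    by (auto simp: adjoin_def)
  then have "adjoin B z = B"
    using maximal subring_set_adjoin subset_adjoin B by blast
  then show False
    using assms self_in_adjoin B by blast
qed

lemma one_minus_power: "b \<in> B \<Longrightarrow> \<exists>c\<in>B. (1 - x * b) ^ n = 1 - x * c"
proof (induction n)
  case 0
  then show ?case by (intro bexI[of _ 0]) (auto simp: subring_set_0 B)
next
  case (Suc n)
  then obtain c where c: "c \<in> B" "(1 - x * b) ^ n = 1 - x * c" by blast
  have "(1 - x * b) ^ Suc n = 1 - x * (b + c - x * b * c)"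
    by (simp only: power_Suc c(2)) (simp add: algebra_simps)
  moreover have "b + c - x * b * c \<in> B"
    using Suc c xB by (intro subring_set_diff subring_set_add subring_set_mult B)
  ultimately show ?case by blast
qed

text \<open>If the inverse of \<open>u = 1 - x b\<close> lay outside \<open>B\<close>, some
  \<open>p\<close> over \<open>B\<close> would satisfy \<open>x * p(1/u) = 1\<close>. Multiplying by
  \<open>u ^ degree p\<close>, again of the form \<open>1 - x c\<close>, turns this into an inverse
  of \<open>x\<close> inside \<open>B\<close>.\<close>

lemma unit:
  assumes b: "b \<in> B"
  shows "inverse (1 - x * b) \<in> B"
proof (rule ccontr)
  let ?u = "1 - x * b"
  assume "inverse ?u \<notin> B"
  then obtain p where p: "poly_over B p" "x * poly p (inverse ?u) = 1"
    using relation by blast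
  have u: "?u \<noteq> 0" "?u \<in> B"
    using noninv b xB by (auto intro!: subring_set_diff subring_set_mult subring_set_1 B)
  obtain c where c: "c \<in> B" "?u ^ degree p = 1 - x * c"
    using one_minus_power b by blast
  have "x * poly (reflect_poly p) ?u = ?u ^ degree p * (x * poly p (inverse ?u))"
    using u by (simp add: poly_reflect_poly_nz)
  then have "x * poly (reflect_poly p) ?u = 1 - x * c"
    using p c by simp
  then have "x * (poly (reflect_poly p) ?u + c) = 1"
    by (simp add: algebra_simps)
  moreover have "poly (reflect_poly p) ?u + c \<in> B"
    using p u c by (intro subring_set_add poly_in_subring poly_over_reflect B)
  ultimately show False
    using noninv by blast
qed

text \<open>If \<open>c\<close> is the constant term of \<open>q\<close>, then
  \<open>1 - x c\<close> is a unit, so the relation for \<open>1/z\<close> can be solved for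
  \<open>z ^ l\<close>, \<open>l = degree q\<close>, as a polynomial in \<open>z\<close> of degree
  below \<open>l\<close>. As \<open>l \<le> degree p\<close>, this rewrites the leading term of
  \<open>p\<close>.\<close>

lemma lower_degree:
  assumes z: "z \<noteq> 0"
    and p: "poly_over B p" "x * poly p z = 1"
    and q: "poly_over B q" "x * poly q (inverse z) = 1"
    and le: "degree q \<le> degree p"
  shows "\<exists>p'. poly_over B p' \<and> x * poly p' z = 1 \<and> degree p' < degree p"
proof -
  obtain c q1 where qc: "q = pCons c q1" by (cases q)
  have c: "c \<in> B"
    using q(1) coeff_pCons_0[of c q1] by (metis poly_over_def qc)
  have q1: "poly_over B q1"
    using q(1) coeff_pCons_Suc[of c q1] by (metis poly_over_def qc)
  have q1nz: "q1 \<noteq> 0"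
    using q(2) qc noninv[OF c] by auto
  define u where "u = 1 - x * c"
  have u: "u \<noteq> 0" "inverse u \<in> B"
    using noninv[OF c] unit[OF c] by (auto simp: u_def)
  have dq: "degree q = Suc (degree q1)"
    using qc q1nz by simp
  define n where "n = degree p"
  define r where "r = reflect_poly q1"
  define l where "l = degree q"
  have rl: "degree r < l"
    using dq degree_reflect_poly_le[of q1] by (simp add: r_def l_def)
  have r: "poly_over B r"
    unfolding r_def by (rule poly_over_reflect[OF B q1])
  have "u = x * inverse z * poly q1 (inverse z)"
    using q(2) by (simp add: u_def qc algebra_simps)
  then have "z ^ l * u = x * poly r z"
    using z by (simp add: r_def l_def dq poly_reflect_poly_nz)
  then have zl: "z ^ l = x * inverse u * poly r z"
    using u by (simp add: field_simps)
  define a where "a = lead_coeff p"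
  have a: "a \<in> B"
    using p(1) by (simp add: a_def poly_over_def)
  \<comment> \<open>The leading monomial \<open>a z^n\<close> is exchanged for
    \<open>a z^(n-l)\<close> times the expression found for \<open>z^l\<close>.\<close>
  define p' where "p' = (p - monom a n) + monom (a * (x * inverse u)) (n - l) * r"
  have ln: "l \<le> n" "l > 0"
    using le dq by (auto simp: l_def n_def)
  have "degree (p - monom a n) < n"
  proof (rule degree_lessI)
    show "p - monom a n \<noteq> 0 \<or> 0 < n" using ln by simp
    show "\<forall>i\<ge>n. coeff (p - monom a n) i = 0"
      by (auto simp: a_def n_def coeff_eq_0)
  qed
  moreover have "degree (monom (a * (x * inverse u)) (n - l) * r) < n"
    using degree_mult_le[of "monom (a * (x * inverse u)) (n - l)" r]
      degree_monom_le[of "a * (x * inverse u)" "n - l"] rl ln by linarith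
  ultimately have "degree p' < n"
    unfolding p'_def by (rule degree_add_less)
  moreover have "poly_over B p'"
    unfolding p'_def
    using a xB u r p(1)
    by (intro poly_over_add poly_over_diff poly_over_mult poly_over_monom subring_set_mult B)
  moreover have "poly p' z = poly p z"
  proof -
    have "z ^ n = z ^ (n - l) * z ^ l"
      using ln by (simp flip: power_add)
    then show ?thesis
      by (simp add: p'_def poly_monom zl algebra_simps)
  qed
  ultimately show ?thesis
    using p by (auto simp: n_def)
qed

lemma total: "z \<in> B \<or> inverse z \<in> B"
proof (rule ccontr)
  assume *: "\<not> ?thesis"
  then have z: "z \<noteq> 0"
    using subring_set_0 B by auto
  have min: "\<exists>p. (poly_over B p \<and> x * poly p y = 1) \<and>
      (\<forall>p'. poly_over B p' \<and> x * poly p' y = 1 \<longrightarrow> degree p \<le> degree p')" if "y \<notin> B" for y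
    using ex_has_least_nat[of "\<lambda>p. poly_over B p \<and> x * poly p y = 1" _ degree] relation[OF that]
    by blast
  obtain p where p: "poly_over B p" "x * poly p z = 1"
    "\<And>p'. poly_over B p' \<Longrightarrow> x * poly p' z = 1 \<Longrightarrow> degree p \<le> degree p'"
    using min * by blast
  obtain q where q: "poly_over B q" "x * poly q (inverse z) = 1"
    "\<And>q'. poly_over B q' \<Longrightarrow> x * poly q' (inverse z) = 1 \<Longrightarrow> degree q \<le> degree q'"
    using min * by blast
  show False
  proof (cases "degree q \<le> degree p")
    case True
    then show False
      using lower_degree[OF z p(1,2) q(1,2)] p(3) by fastforce
  next
    case False
    then show False
      using lower_degree[of "inverse z" q p] z p q by fastforce
  qed
qed

end

text \<open>Zorn's lemma applies to the overrings of \<open>A\<close> in which \<open>x\<close> has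
  no inverse; \<open>total\<close> shows that a maximal one is a valuation ring.\<close>

lemma exists_valuation_ring:
  fixes A :: "'a::field set"
  assumes A: "subring_set A" "x \<in> A" "\<And>a. a \<in> A \<Longrightarrow> x * a \<noteq> 1"
  obtains B where "A \<subseteq> B" "subring_set B" "\<And>b. b \<in> B \<Longrightarrow> x * b \<noteq> 1"
    "\<And>z. z \<in> B \<or> inverse z \<in> B"
proof -
  define C where "C = {B. A \<subseteq> B \<and> subring_set B \<and> (\<forall>b\<in>B. x * b \<noteq> 1)}"
  have "\<exists>B\<in>C. \<forall>X\<in>C. B \<subseteq> X \<longrightarrow> X = B"
  proof (rule subset_Zorn_nonempty)
    show "C \<noteq> {}" using A by (auto simp: C_def)
    fix K assume K: "K \<noteq> {}" "subset.chain C K"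
    have KC: "B \<in> K \<Longrightarrow> B \<in> C" for B
      using K by (auto simp: subset.chain_def)
    have "subring_set (\<Union>K)"
      unfolding subring_set_def
    proof (intro conjI ballI)
      show "1 \<in> \<Union>K"
        using K(1) KC by (auto simp: C_def dest: subring_set_1)
      fix y z assume "y \<in> \<Union>K" "z \<in> \<Union>K"
      then obtain Y Z where YZ: "Y \<in> K" "y \<in> Y" "Z \<in> K" "z \<in> Z" by blast
      have "Y \<subseteq> Z \<or> Z \<subseteq> Y"
        using K(2) YZ by (auto simp: subset_chain_def)
      then obtain W where W: "W \<in> K" "y \<in> W" "z \<in> W"
        using YZ by blast
      then have "subring_set W"
        using KC by (auto simp: C_def)
      then show "y - z \<in> \<Union>K" "y * z \<in> \<Union>K"
        using W subring_set_diff subring_set_mult by blast+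
    qed
    then show "\<Union>K \<in> C"
      using K(1) KC by (auto simp: C_def)
  qed
  then obtain B where mB: "B \<in> C" "\<And>X. X \<in> C \<Longrightarrow> B \<subseteq> X \<Longrightarrow> X = B" by blast
  interpret maximal_noninvertible B x
  proof
    show "D = B" if "subring_set D" "B \<subseteq> D" "\<forall>c\<in>D. x * c \<noteq> 1" for D
      using mB that by (auto simp: C_def)
  qed (use mB A in \<open>auto simp: C_def\<close>)
  show thesis
  proof (rule that)
    show "A \<subseteq> B"
      using mB(1) by (simp add: C_def)
  qed (use B noninv total in auto)
qed

section \<open>Polynomials in two variables over a valuation ring\<close>

text \<open>The last assumption means residue characteristic zero: the positive integer factors
  produced by differentiation are units.\<close>

locale valuation_ring =
  fixes V :: "'a::field_char_0 set"
  assumes V: "subring_set V"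
    and total: "x \<in> V \<or> inverse x \<in> V"
    and inverse_of_nat: "inverse (of_nat n) \<in> V"
begin

text \<open>The maximal ideal, as the set of nonunits. Zero is listed separately because
  \<open>inverse 0 = 0\<close> belongs to \<open>V\<close>.\<close>

definition M :: "'a set" where
  "M = {x \<in> V. x = 0 \<or> inverse x \<notin> V}"

lemma M_subset: "x \<in> M \<Longrightarrow> x \<in> V"
  by (simp add: M_def)

lemma zero_in_M [simp]: "0 \<in> M"
  by (simp add: M_def subring_set_0 V)

lemma one_notin_M [simp]: "1 \<notin> M"
  by (simp add: M_def subring_set_1 V)

lemma of_nat_in_V: "of_nat n \<in> V"
  by (induction n) (auto intro: subring_set_add subring_set_0 subring_set_1 V)

lemma of_nat_notin_M: "n > 0 \<Longrightarrow> of_nat n \<notin> M"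
  by (simp add: M_def inverse_of_nat)

lemma M_mult: 
  assumes "x \<in> V" "y \<in> M"
  shows "x * y \<in> M"
proof -
  have "y \<in> V" using assms M_subset by blast
  have "inverse (x * y) \<notin> V" if "x * y \<noteq> 0"
  proof
    assume "inverse (x * y) \<in> V"
    then have "x * inverse (x * y) \<in> V"
      using assms by (intro subring_set_mult V)
    then have "inverse y \<in> V"
      using that by (simp add: mult.assoc[symmetric])
    then show False
      using assms that by (auto simp: M_def)
  qed
  then show ?thesis
    using assms \<open>y \<in> V\<close> by (auto simp: M_def intro: subring_set_mult V)
qed

lemma M_mult': "x \<in> M \<Longrightarrow> y \<in> V \<Longrightarrow> x * y \<in> M"
  using M_mult[of y x] by (simp add: mult.commute)

lemma M_prime:
  assumes "x \<in> V" "y \<in> V" "x \<notin> M" "y \<notin> M"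
  shows "x * y \<notin> M"
  using assms subring_set_mult[OF V, of "inverse x" "inverse y"] by (auto simp: M_def)

lemma M_add:
  assumes "x \<in> M" "y \<in> M"
  shows "x + y \<in> M"
proof -
  have aux: "u + v \<in> M" if "u \<in> M" "v \<in> M" "v \<noteq> 0" "u * inverse v \<in> V" for u v
  proof -
    have "(u * inverse v + 1) * v \<in> M"
      using that by (intro M_mult subring_set_add subring_set_1 V)
    then show ?thesis using that by (simp add: algebra_simps)
  qed
  show ?thesis
  proof (cases "x = 0 \<or> y = 0")
    case False
    then show ?thesis
      using aux[OF assms] aux[OF assms(2,1)] total[of "x * inverse y"]
      by (auto simp: add.commute mult.commute)
  qed (use assms in auto)
qed

lemma M_minus: "x \<in> M \<Longrightarrow> - x \<in> M"
  using M_mult[of "-1" x] subring_set_diff[OF V subring_set_0[OF V] subring_set_1[OF V]] by simp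

lemma M_diff: "x \<in> M \<Longrightarrow> y \<in> M \<Longrightarrow> x - y \<in> M"
  using M_add[of x "- y"] M_minus by simp

lemma M_sum: "(\<And>i. i \<in> I \<Longrightarrow> f i \<in> M) \<Longrightarrow> sum f I \<in> M"
  by (induction I rule: infinite_finite_induct) (auto intro: M_add)

text \<open>\<open>\<mu>\<close> has the least valuation in \<open>S\<close>. When \<open>a\<close>
  is added, it replaces the old choice just if \<open>a / \<mu>\<close> is not in \<open>V\<close>,
  in which case \<open>\<mu> / a\<close> is.\<close>

lemma exists_max_valuation:
  assumes "finite S" "s \<in> S" "s \<noteq> 0"
  obtains \<mu> where "\<mu> \<in> S" "\<mu> \<noteq> 0" "\<And>s. s \<in> S \<Longrightarrow> s / \<mu> \<in> V"
proof -
  have "\<exists>\<mu>\<in>S. \<mu> \<noteq> 0 \<and> (\<forall>s\<in>S. s / \<mu> \<in> V)"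
    using assms
  proof (induction S arbitrary: s rule: finite_induct)
    case (insert a S)
    show ?case
    proof (cases "\<exists>s\<in>S. s \<noteq> 0")
      case False
      then show ?thesis
        using insert.prems by (intro bexI[of _ s]) (auto simp: subring_set_0 subring_set_1 V)
    next
      case True
      then obtain \<mu> where \<mu>: "\<mu> \<in> S" "\<mu> \<noteq> 0" "\<And>s. s \<in> S \<Longrightarrow> s / \<mu> \<in> V"
        using insert.IH by blast
      show ?thesis
      proof (cases "a / \<mu> \<in> V")
        case True
        then show ?thesis using \<mu> by auto
      next
        case False
        then have a: "a \<noteq> 0" "\<mu> / a \<in> V"
          using total[of "a / \<mu>"] subring_set_0[OF V] by auto
        have "s / a \<in> V" if "s \<in> S" for s
          using subring_set_mult[OF V \<mu>(3)[OF that] a(2)] \<mu>(2) by simp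
        then show ?thesis
          using a subring_set_1[OF V] by (intro bexI[of _ a]) auto
      qed
    qed
  qed simp
  then show thesis using that by blast
qed

end

text \<open>The outer variable is read as \<open>x\<close> and the inner one as \<open>y\<close>, so
  this is the coefficient of \<open>x^b y^c\<close>.\<close>

definition coeff2 :: "'a::zero poly poly \<Rightarrow> nat \<Rightarrow> nat \<Rightarrow> 'a" where
  "coeff2 p b c = coeff (coeff p b) c"

definition const2 :: "'a::comm_ring_1 \<Rightarrow> 'a poly poly" where
  "const2 t = [:[:t:]:]"

abbreviation dx :: "'a::idom poly poly \<Rightarrow> 'a poly poly" where
  "dx \<equiv> pderiv"

abbreviation dy :: "'a::idom poly poly \<Rightarrow> 'a poly poly" where
  "dy \<equiv> map_poly pderiv"

lemma coeff2_0 [simp]: "coeff2 0 b c = 0"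
  by (simp add: coeff2_def)

lemma coeff2_add [simp]: "coeff2 (p + q) b c = coeff2 p b c + coeff2 q b c"
  by (simp add: coeff2_def)

lemma coeff2_diff [simp]: "coeff2 (p - q) b c = coeff2 p b c - coeff2 (q :: 'a::ab_group_add poly poly) b c"
  by (simp add: coeff2_def)

lemma coeff2_const_mult [simp]: "coeff2 (const2 t * p) b c = t * coeff2 p b c"
  by (simp add: coeff2_def const2_def)

lemma coeff2_mult: "coeff2 (p * q) b c = (\<Sum>i\<le>b. \<Sum>j\<le>c. coeff2 p i j * coeff2 q (b - i) (c - j))"
  by (simp add: coeff2_def coeff_mult coeff_sum)

lemma coeff2_dx: "coeff2 (dx p) b c = of_nat (Suc b) * coeff2 p (Suc b) c"
  by (simp add: coeff2_def coeff_pderiv of_nat_poly del: of_nat_Suc)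

lemma coeff2_dy: "coeff2 (dy p) b c = of_nat (Suc c) * coeff2 p b (Suc c)"
  by (simp add: coeff2_def coeff_pderiv coeff_map_poly)

lemma coeff2_monom_mult:
  "coeff2 (monom (monom s j) i * p) b c = (if i \<le> b \<and> j \<le> c then s * coeff2 p (b - i) (c - j) else 0)"
  for p :: "'a::comm_ring_1 poly poly"
  by (simp add: coeff2_def coeff_monom_mult)

lemma coeff2_eqI: "(\<And>b c. coeff2 p b c = coeff2 q b c) \<Longrightarrow> p = q"
  by (simp add: coeff2_def poly_eq_iff)

lemma finite_coeff2: "finite {(b, c). coeff2 p b c \<noteq> 0}"
proof (rule finite_subset)
  show "{(b, c). coeff2 p b c \<noteq> 0} \<subseteq> (SIGMA b:{..degree p}. {..degree (coeff p b)})"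
    by (auto simp: coeff2_def intro!: le_degree)
qed auto

lemma finite_coeff2_values: "finite {coeff2 p b c | b c. True}"
proof (rule finite_subset)
  show "{coeff2 p b c | b c. True} \<subseteq> insert 0 ((\<lambda>(b, c). coeff2 p b c) ` {(b, c). coeff2 p b c \<noteq> 0})"
    by force
qed (simp add: finite_coeff2)

lemma dx_const_mult: "dx (const2 t * p) = const2 t * dx p"
  by (intro coeff2_eqI) (simp add: coeff2_dx)

lemma dy_const_mult: "dy (const2 t * p) = const2 t * dy p"
  by (intro coeff2_eqI) (simp add: coeff2_dy)

section \<open>Reduction modulo the maximal ideal and Gauss's lemma\<close>

context valuation_ring
begin

definition integral :: "'a poly poly \<Rightarrow> bool" where
  "integral p \<longleftrightarrow> (\<forall>b c. coeff2 p b c \<in> V)"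

definition negligible :: "'a poly poly \<Rightarrow> bool" where
  "negligible p \<longleftrightarrow> (\<forall>b c. coeff2 p b c \<in> M)"

lemma integral_add: "integral p \<Longrightarrow> integral q \<Longrightarrow> integral (p + q)"
  by (simp add: integral_def subring_set_add V)

lemma integral_diff: "integral p \<Longrightarrow> integral q \<Longrightarrow> integral (p - q)"
  by (simp add: integral_def subring_set_diff V)

lemma integral_mult: "integral p \<Longrightarrow> integral q \<Longrightarrow> integral (p * q)"
  by (simp add: integral_def coeff2_mult subring_set_sum subring_set_mult V)

lemma integral_const_mult: "t \<in> V \<Longrightarrow> integral p \<Longrightarrow> integral (const2 t * p)"
  by (simp add: integral_def subring_set_mult V)

lemma integral_dx: "integral p \<Longrightarrow> integral (dx p)"
  unfolding integral_def coeff2_dx by (blast intro: subring_set_mult V of_nat_in_V)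

lemma integral_dy: "integral p \<Longrightarrow> integral (dy p)"
  unfolding integral_def coeff2_dy by (blast intro: subring_set_mult V of_nat_in_V)

lemma integral_monom: "t \<in> V \<Longrightarrow> integral (monom (monom t j) i)"
  by (simp add: integral_def coeff2_def coeff_monom subring_set_0 V)

lemma negligible_diff: "negligible p \<Longrightarrow> negligible q \<Longrightarrow> negligible (p - q)"
  by (simp add: negligible_def M_diff)

lemma negligible_add: "negligible p \<Longrightarrow> negligible q \<Longrightarrow> negligible (p + q)"
  by (simp add: negligible_def M_add)

lemma negligible_mult: "integral p \<Longrightarrow> negligible q \<Longrightarrow> negligible (p * q)"
  by (simp add: integral_def negligible_def coeff2_mult M_sum M_mult)

lemma negligible_const_mult: "t \<in> M \<Longrightarrow> integral p \<Longrightarrow> negligible (const2 t * p)"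
  by (simp add: integral_def negligible_def M_mult')

text \<open>The leading monomial of the reduction of \<open>p\<close> modulo \<open>M\<close>, in
  lexicographic order with \<open>y\<close> dominating \<open>x\<close>.\<close>

definition leading :: "'a poly poly \<Rightarrow> nat \<Rightarrow> nat \<Rightarrow> bool" where
  "leading p b c \<longleftrightarrow> coeff2 p b c \<notin> M \<and>
     (\<forall>b' c'. c' > c \<or> c' = c \<and> b' > b \<longrightarrow> coeff2 p b' c' \<in> M)"

lemma leading_beyond: "leading p b c \<Longrightarrow> c' > c \<or> c' = c \<and> b' > b \<Longrightarrow> coeff2 p b' c' \<in> M"
  unfolding leading_def by blast

lemma exists_leading:
  assumes "\<not> negligible p"
  obtains b c where "leading p b c"
proof -
  define S where "S = {(b, c). coeff2 p b c \<notin> M}"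
  have S: "finite S"
    by (rule finite_subset[OF _ finite_coeff2[of p]]) (auto simp: S_def)
  have "S \<noteq> {}"
    using assms by (auto simp: S_def negligible_def)
  define c where "c = Max (snd ` S)"
  have c: "c \<in> snd ` S" "\<And>b' c'. (b', c') \<in> S \<Longrightarrow> c' \<le> c"
    unfolding c_def using S \<open>S \<noteq> {}\<close> by (auto intro!: Max_in Max_ge image_eqI[of _ snd])
  define R where "R = {b. (b, c) \<in> S}"
  have R: "finite R" "R \<noteq> {}"
    using c(1) finite_subset[of R "fst ` S"] S by (force simp: R_def)+
  have "leading p (Max R) c"
    unfolding leading_def
  proof (intro conjI allI impI)
    show "coeff2 p (Max R) c \<notin> M"
      using Max_in[OF R] by (simp add: R_def S_def)
    fix b' c' assume "c' > c \<or> c' = c \<and> b' > Max R"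
    then show "coeff2 p b' c' \<in> M"
    proof
      assume "c' > c"
      then show ?thesis using c(2)[of b' c'] by (auto simp: S_def)
    next
      assume "c' = c \<and> b' > Max R"
      then show ?thesis using Max_ge[OF R(1), of b'] by (auto simp: R_def S_def)
    qed
  qed
  then show thesis by (rule that)
qed

text \<open>In the convolution every other pair of exponents has a factor beyond its leading
  monomial, hence in \<open>M\<close>; what remains is a product of two units.\<close>

lemma leading_mult:
  assumes "integral p" "integral q" "leading p b1 c1" "leading q b2 c2"
  shows "coeff2 (p * q) (b1 + b2) (c1 + c2) \<notin> M"
proof
  assume *: "coeff2 (p * q) (b1 + b2) (c1 + c2) \<in> M"
  define I where "I = {..b1 + b2} \<times> {..c1 + c2}"
  define f where "f = (\<lambda>(i, j). coeff2 p i j * coeff2 q (b1 + b2 - i) (c1 + c2 - j))"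
  have pV: "coeff2 p i j \<in> V" and qV: "coeff2 q i j \<in> V" for i j
    using assms by (auto simp: integral_def)
  have "f x \<in> M" if x: "x \<in> I - {(b1, c1)}" for x
  proof -
    obtain i j where ij: "x = (i, j)" by (cases x)
    have "(j > c1 \<or> j = c1 \<and> i > b1) \<or>
      (c1 + c2 - j > c2 \<or> c1 + c2 - j = c2 \<and> b1 + b2 - i > b2)"
      using x ij unfolding I_def by auto
    then have "coeff2 p i j \<in> M \<or> coeff2 q (b1 + b2 - i) (c1 + c2 - j) \<in> M"
      using leading_beyond assms by blast
    then show ?thesis
      using pV qV by (auto simp: f_def ij intro: M_mult M_mult')
  qed
  then have rest: "sum f (I - {(b1, c1)}) \<in> M"
    by (rule M_sum)
  have "coeff2 (p * q) (b1 + b2) (c1 + c2) = sum f I"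
    by (simp add: coeff2_mult I_def f_def sum.cartesian_product)
  also have "\<dots> = f (b1, c1) + sum f (I - {(b1, c1)})"
    by (rule sum.remove) (auto simp: I_def)
  finally have "f (b1, c1) \<in> M"
    using M_diff[OF * rest] by simp
  then show False
    using M_prime[OF pV qV] assms by (auto simp: f_def leading_def)
qed

lemma not_negligible_mult:
  assumes "integral p" "integral q" "\<not> negligible p" "\<not> negligible q"
  shows "\<not> negligible (p * q)"
proof -
  obtain b1 c1 b2 c2 where "leading p b1 c1" "leading q b2 c2"
    using assms exists_leading by metis
  then show ?thesis
    using leading_mult[OF assms(1,2)] unfolding negligible_def by blast
qed

text \<open>Dividing by a coefficient of least valuation keeps all coefficients in \<open>V\<close>
  and makes one of them equal to 1.\<close>

lemma exists_primitive_multiple: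
  assumes "p \<noteq> 0"
  obtains \<mu> where "\<mu> \<noteq> 0" "\<mu> \<in> {coeff2 p b c | b c. True}"
    "integral (const2 (inverse \<mu>) * p)" "\<not> negligible (const2 (inverse \<mu>) * p)"
proof -
  define S where "S = {coeff2 p b c | b c. True}"
  obtain b c where "coeff2 p b c \<noteq> 0"
    using coeff2_eqI[of p 0] assms by auto
  moreover have "coeff2 p b c \<in> S" for b c
    by (auto simp: S_def)
  moreover have "finite S"
    unfolding S_def by (rule finite_coeff2_values)
  ultimately obtain \<mu> where \<mu>: "\<mu> \<in> S" "\<mu> \<noteq> 0" "\<And>s. s \<in> S \<Longrightarrow> s / \<mu> \<in> V"
    using exists_max_valuation by metis
  obtain b c where bc: "\<mu> = coeff2 p b c"
    using \<mu>(1) by (auto simp: S_def)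
  show thesis
  proof (rule that)
    show "\<mu> \<in> {coeff2 p b c | b c. True}" using bc by blast
    have "coeff2 p b c / \<mu> \<in> V" for b c
      by (rule \<mu>(3)) (auto simp: S_def)
    then show "integral (const2 (inverse \<mu>) * p)"
      by (simp add: integral_def divide_inverse mult.commute[of "inverse \<mu>"])
    show "\<not> negligible (const2 (inverse \<mu>) * p)"
      unfolding negligible_def coeff2_const_mult
      using bc \<mu>(2) one_notin_M left_inverse by metis
  qed (rule \<mu>)
qed

text \<open>Make \<open>l\<close> primitive by dividing by \<open>\<mu>\<close>. If
  \<open>\<mu>\<close> were outside \<open>V\<close>, then \<open>1/\<mu>\<close> would be in
  \<open>M\<close>, and the product of the primitive polynomials \<open>l/\<mu>\<close> and
  \<open>f\<close> would vanish modulo \<open>M\<close>.\<close>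

lemma gauss:
  assumes f: "integral f" "\<not> negligible f" and lf: "integral (l * f)"
  shows "integral l"
proof (cases "l = 0")
  case False
  then obtain \<mu> where \<mu>: "\<mu> \<noteq> 0" "integral (const2 (inverse \<mu>) * l)"
    "\<not> negligible (const2 (inverse \<mu>) * l)"
    using exists_primitive_multiple by metis
  have l: "l = const2 \<mu> * (const2 (inverse \<mu>) * l)"
    using \<mu>(1) by (intro coeff2_eqI) simp
  show ?thesis
  proof (cases "\<mu> \<in> V")
    case True
    then show ?thesis
      using integral_const_mult \<mu>(2) l by metis
  next
    case False
    then have "inverse \<mu> \<in> M"
      using total[of \<mu>] by (simp add: M_def)
    then have "negligible (const2 (inverse \<mu>) * (l * f))"
      using lf by (rule negligible_const_mult)
    then show ?thesis
      using not_negligible_mult[OF \<mu>(2) f(1) \<mu>(3) f(2)] by (simp add: mult.assoc)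
  qed
qed (simp add: integral_def subring_set_0 V)

end

section \<open>Perturbations of Shamsuddin's derivation\<close>

definition shamsuddin :: "nat \<Rightarrow> 'a::field_char_0 poly poly \<Rightarrow> 'a poly poly" where
  "shamsuddin m f = dx f + (monom (monom 1 1) m + 1) * dy f"

lemma coeff2_shamsuddin:
  "coeff2 (shamsuddin m f) b c = of_nat (Suc b) * coeff2 f (Suc b) c +
     (if m \<le> b then of_nat c * coeff2 f (b - m) c else 0) + of_nat (Suc c) * coeff2 f b (Suc c)"
  by (cases c) (auto simp: shamsuddin_def coeff2_dx coeff2_dy coeff2_monom_mult distrib_right
      simp del: of_nat_Suc)

lemma shamsuddin_const_mult: "shamsuddin m (const2 t * f) = const2 t * shamsuddin m f"
  by (simp only: shamsuddin_def dx_const_mult dy_const_mult distrib_left mult.left_commute)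

context valuation_ring
begin

lemma integral_shamsuddin: "integral f \<Longrightarrow> integral (shamsuddin m f)"
proof -
  have "1 = monom (monom 1 0 :: 'a poly) 0"
    by (simp add: monom_0 flip: one_pCons)
  then have "integral 1"
    using integral_monom[OF subring_set_1[OF V]] by metis
  then show "integral f \<Longrightarrow> integral (shamsuddin m f)"
    unfolding shamsuddin_def
    by (intro integral_add integral_mult integral_dx integral_dy integral_monom subring_set_1 V)
qed

lemma of_nat_mult_in_M: "x \<in> M \<Longrightarrow> of_nat n * x \<in> M"
  by (rule M_mult[OF of_nat_in_V])

lemma of_nat_mult_notin_M: "n > 0 \<Longrightarrow> x \<in> V \<Longrightarrow> x \<notin> M \<Longrightarrow> of_nat n * x \<notin> M"
  by (intro M_prime of_nat_in_V of_nat_notin_M)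

text \<open>If \<open>s\<close> is the \<open>y\<close>-degree of \<open>f\<close> modulo \<open>M\<close>, comparing leading monomials (with \<open>y\<close> dominating)
  shows \<open>l = s x\<^sup>m\<close>. The next row is an equation \<open>g' - x\<^sup>m g + s c = 0\<close> with a nonzero constant \<open>c\<close>, and
  it has no polynomial solution unless \<open>s = 0\<close>.\<close>

lemma shamsuddin_darboux:
  assumes m: "m \<ge> 1"
    and f: "integral f" "\<not> negligible f" and l: "integral l"
    and eq: "negligible (shamsuddin m f - l * f)"
  shows "negligible l" "(b, c) \<noteq> (0, 0) \<Longrightarrow> coeff2 f b c \<in> M" "coeff2 f 0 0 \<notin> M"
proof -
  have fV: "coeff2 f b c \<in> V" for b c
    using f by (simp add: integral_def)
  obtain b0 s where lead: "leading f b0 s"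
    using exists_leading f(2) by blast
  note beyond = leading_beyond[OF lead]
  define l' where "l' = l - monom (monom (of_nat s) 0) m"
  have l': "integral l'"
    unfolding l'_def by (intro integral_diff l integral_monom of_nat_in_V)
  have D: "coeff2 (shamsuddin m f - l * f) b c = of_nat (Suc b) * coeff2 f (Suc b) c +
      (if m \<le> b then (of_nat c - of_nat s) * coeff2 f (b - m) c else 0) +
      of_nat (Suc c) * coeff2 f b (Suc c) - coeff2 (l' * f) b c" for b c
    by (simp add: l'_def coeff2_shamsuddin left_diff_distrib coeff2_monom_mult)
  have "negligible l'"
  proof (rule ccontr)
    assume "\<not> negligible l'"
    then obtain b1 c1 where lead': "leading l' b1 c1"
      using exists_leading by blast
    let ?b = "b1 + b0" and ?c = "c1 + s"
    have "coeff2 (shamsuddin m f - l * f) ?b ?c \<in> M"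
      using eq by (simp add: negligible_def)
    moreover have "of_nat (Suc ?b) * coeff2 f (Suc ?b) ?c \<in> M"
      by (intro of_nat_mult_in_M beyond) auto
    \<comment> \<open>Since \<open>y d/dy\<close> multiplies \<open>y^c\<close> by \<open>c\<close>,
      splitting \<open>s x^m\<close> off \<open>l\<close> cancels row \<open>s\<close>; higher rows
      of \<open>f\<close> are in \<open>M\<close> anyway.\<close>
    moreover have "(of_nat ?c - of_nat s) * coeff2 f (?b - m) ?c \<in> M"
    proof (cases "c1 = 0")
      case False
      then have "of_nat c1 * coeff2 f (?b - m) ?c \<in> M"
        by (intro of_nat_mult_in_M beyond) auto
      then show ?thesis by simp
    qed simp
    moreover have "of_nat (Suc ?c) * coeff2 f ?b (Suc ?c) \<in> M"
      by (intro of_nat_mult_in_M beyond) auto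
    ultimately have "coeff2 (l' * f) ?b ?c \<in> M"
      using D[of ?b ?c] M_diff[of "of_nat (Suc ?b) * coeff2 f (Suc ?b) ?c +
      (if m \<le> ?b then (of_nat ?c - of_nat s) * coeff2 f (?b - m) ?c else 0) +
      of_nat (Suc ?c) * coeff2 f ?b (Suc ?c)" "coeff2 (shamsuddin m f - l * f) ?b ?c"]
      by (auto intro!: M_add split: if_splits simp del: of_nat_Suc of_nat_add)
    then show False
      using leading_mult[OF l' f(1) lead' lead] by simp
  qed
  then have "negligible (l' * f)"
    using negligible_mult[OF f(1) \<open>negligible l'\<close>] by (simp add: mult.commute)
  then have eq': "of_nat (Suc b) * coeff2 f (Suc b) c +
      (if m \<le> b then (of_nat c - of_nat s) * coeff2 f (b - m) c else 0) +
      of_nat (Suc c) * coeff2 f b (Suc c) \<in> M" for b c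
  proof -
    have "coeff2 (shamsuddin m f - l * f) b c \<in> M" "coeff2 (l' * f) b c \<in> M"
      using eq \<open>negligible (l' * f)\<close> by (auto simp only: negligible_def)
    from M_add[OF this] show ?thesis
      unfolding D by (simp only: diff_add_cancel)
  qed
  \<comment> \<open>In row \<open>s\<close> the \<open>x^m\<close> term cancels and the row above is
    in \<open>M\<close>, so only the \<open>x\<close>-derivative remains: the top row is constant
    modulo \<open>M\<close>.\<close>
  have top: "coeff2 f (Suc b) s \<in> M" for b
  proof (rule ccontr)
    assume "coeff2 f (Suc b) s \<notin> M"
    then have "of_nat (Suc b) * coeff2 f (Suc b) s \<notin> M"
      using fV by (intro of_nat_mult_notin_M) auto
    moreover have "of_nat (Suc s) * coeff2 f b (Suc s) \<in> M"
      by (intro of_nat_mult_in_M beyond) auto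
    ultimately show False
      using eq'[of b s] M_diff[of "of_nat (Suc b) * coeff2 f (Suc b) s + of_nat (Suc s) * coeff2 f b (Suc s)"
          "of_nat (Suc s) * coeff2 f b (Suc s)"]
      by (auto split: if_splits)
  qed
  have f0: "coeff2 f 0 s \<notin> M"
    using lead top[of "b0 - 1"] by (cases b0) (auto simp: leading_def)
  have s0: "s = 0"
  proof (rule ccontr)
    assume "s \<noteq> 0"
    then obtain r where r: "s = Suc r" by (cases s) auto
    have row: "coeff2 f b r \<in> M" for b
    proof (rule ccontr)
      assume *: "coeff2 f b r \<notin> M"
      define S where "S = {b. coeff2 f b r \<notin> M}"
      have "S \<subseteq> fst ` {(b, c). coeff2 f b c \<noteq> 0}"
      proof
        fix b assume "b \<in> S"
        then have "coeff2 f b r \<noteq> 0"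
          using zero_in_M by (auto simp only: S_def mem_Collect_eq)
        then show "b \<in> fst ` {(b, c). coeff2 f b c \<noteq> 0}" by force
      qed
      then have S: "finite S" "S \<noteq> {}"
        using finite_subset finite_coeff2[of f] * by (auto simp: S_def)
      \<comment> \<open>If row \<open>r\<close> had \<open>x\<close>-degree \<open>\<beta>\<close>
        modulo \<open>M\<close>, its multiple by \<open>x^m\<close> would have nothing to cancel
        against in \<open>x^(\<beta>+m)\<close>: the derivative has lower degree, and row
        \<open>s\<close> contributes only to \<open>x^0\<close>, while
        \<open>m \<ge> 1\<close>.\<close>
      define \<beta> where "\<beta> = Max S"
      have \<beta>: "coeff2 f \<beta> r \<notin> M" "\<And>b. b > \<beta> \<Longrightarrow> coeff2 f b r \<in> M"
        using Max_in[OF S] Max_ge[OF S(1)] unfolding \<beta>_def S_def by fastforce+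
      have "of_nat (Suc (\<beta> + m)) * coeff2 f (Suc (\<beta> + m)) r \<in> M"
        by (intro of_nat_mult_in_M \<beta>) auto
      moreover have "of_nat (Suc r) * coeff2 f (\<beta> + m) (Suc r) \<in> M"
        using top[of "\<beta> + m - 1"] m r by (intro of_nat_mult_in_M) auto
      ultimately have "(of_nat r - of_nat s) * coeff2 f \<beta> r \<in> M"
        using eq'[of "\<beta> + m" r] M_add[of "of_nat (Suc (\<beta> + m)) * coeff2 f (Suc (\<beta> + m)) r"
            "of_nat (Suc r) * coeff2 f (\<beta> + m) (Suc r)"]
          M_diff[of "of_nat (Suc (\<beta> + m)) * coeff2 f (Suc (\<beta> + m)) r + (of_nat r - of_nat s) * coeff2 f \<beta> r
              + of_nat (Suc r) * coeff2 f (\<beta> + m) (Suc r)"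
            "of_nat (Suc (\<beta> + m)) * coeff2 f (Suc (\<beta> + m)) r + of_nat (Suc r) * coeff2 f (\<beta> + m) (Suc r)"]
        by (simp del: of_nat_Suc add: algebra_simps)
      then show False
        using \<beta>(1) M_minus by (fastforce simp: r)
    qed
    \<comment> \<open>In \<open>x^0\<close> there is no \<open>x^m\<close> term and row
      \<open>r\<close> is in \<open>M\<close>, which leaves \<open>s\<close> times the constant of
      row \<open>s\<close>.\<close>
    have "of_nat (Suc r) * coeff2 f 0 (Suc r) \<in> M"
      using M_diff[OF eq'[of 0 r] of_nat_mult_in_M[OF row, of "Suc 0" "Suc 0"]] m by simp
    then show False
      using of_nat_mult_notin_M[of "Suc r" "coeff2 f 0 (Suc r)"] f0 fV r by auto
  qed
  show "negligible l"
    using \<open>negligible l'\<close> by (simp add: l'_def s0)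
  show "coeff2 f 0 0 \<notin> M"
    using f0 s0 by simp
  show "coeff2 f b c \<in> M" if "(b, c) \<noteq> (0, 0)"
    using that beyond[of c b] top[of "b - 1"] s0 by (cases c; cases b) auto
qed

text \<open>Modulo \<open>M\<close> the primitive curve solves the unperturbed equation, so it is
  constant there and its cofactor is zero. The contradiction sits at the next order: dividing
  \<open>t\<close> and the terms of positive \<open>y\<close>-degree of curve and cofactor by one of
  least valuation, all quotients turn out to lie in \<open>M\<close>, although one of them is
  1.\<close>

lemma no_darboux_pencil:
  assumes m: "m \<ge> 1" and k: "k \<ge> 2" "k \<le> m + 1" and n: "n \<ge> 1"
    and t: "t \<in> M" "t \<noteq> 0" and z: "integral z1" "integral z2" and f: "f \<noteq> 0"
    and eq: "shamsuddin m f + const2 t * (z1 * dx f + z2 * dy f) = l * f"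
    and degree_l: "\<And>b c. coeff2 l b c \<noteq> 0 \<Longrightarrow> b + k * c \<le> m + 1"
    and top_l: "coeff2 l (m + 1 - k) 1 = of_nat n * t"
  shows False
proof -
  obtain \<nu> where \<nu>: "\<nu> \<noteq> 0" "integral (const2 (inverse \<nu>) * f)"
    "\<not> negligible (const2 (inverse \<nu>) * f)"
    using exists_primitive_multiple f by metis
  define f1 where "f1 = const2 (inverse \<nu>) * f"
  define e where "e g = z1 * dx g + z2 * dy g" for g
  have e_const: "e (const2 a * g) = const2 a * e g" for a g
    by (simp only: e_def dx_const_mult dy_const_mult distrib_left mult.left_commute)
  have e_int: "integral (e g)" if "integral g" for g
    unfolding e_def by (intro integral_add integral_mult integral_dx integral_dy z that)
  have tV: "t \<in> V" using t M_subset by blast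
  have "const2 (inverse \<nu>) * (shamsuddin m f + const2 t * e f) = const2 (inverse \<nu>) * (l * f)"
    using eq by (simp add: e_def)
  then have eq1: "shamsuddin m f1 + const2 t * e f1 = l * f1"
    by (simp add: f1_def shamsuddin_const_mult e_const distrib_left mult.assoc mult.left_commute)
  have f1: "integral f1" "\<not> negligible f1"
    using \<nu> by (auto simp: f1_def)
  have f1V: "coeff2 f1 b c \<in> V" for b c
    using f1 by (simp add: integral_def)
  have l: "integral l"
    by (rule gauss[OF f1])
      (unfold eq1[symmetric], intro integral_add integral_shamsuddin integral_const_mult e_int f1 tV)
  have "shamsuddin m f1 - l * f1 = - (const2 t * e f1)"
    using eq1 by (simp add: algebra_simps eq_neg_iff_add_eq_0)
  then have "negligible (shamsuddin m f1 - l * f1)"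
    using negligible_const_mult[OF t(1) e_int[OF f1(1)]]
      negligible_diff[of 0 "const2 t * e f1"] by (simp add: negligible_def)
  note dar = shamsuddin_darboux[OF m f1 l this]


  define tail where "tail p = p - map_poly (\<lambda>q. [:coeff q 0:]) p" for p :: "'a poly poly"
  have coeff2_tail: "coeff2 (tail p) b c = (if c = 0 then 0 else coeff2 p b c)" for p b c
    by (cases c) (auto simp: tail_def coeff2_def coeff_map_poly)
  \<comment> \<open>Including \<open>t\<close> provides a nonzero element even if both tails vanish,
    and makes \<open>t / \<mu>\<close> integral.\<close>
  define S where "S = insert t ({coeff2 (tail f1) b c | b c. True} \<union> {coeff2 (tail l) b c | b c. True})"
  have "finite S"
    unfolding S_def by (intro finite.insertI finite_UnI finite_coeff2_values)
  then obtain \<mu> where \<mu>: "\<mu> \<in> S" "\<mu> \<noteq> 0" "\<And>s. s \<in> S \<Longrightarrow> s / \<mu> \<in> V"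
    using exists_max_valuation[of S t] t(2) by (auto simp: S_def)
  define g where "g = const2 (inverse \<mu>) * tail f1"
  define lam where "lam = const2 (inverse \<mu>) * tail l"
  define \<tau> where "\<tau> = t / \<mu>"
  have gV: "coeff2 g b c \<in> V" for b c
  proof -
    have "coeff2 (tail f1) b c / \<mu> \<in> V"
      by (rule \<mu>(3)) (auto simp: S_def)
    then show ?thesis
      by (simp add: g_def divide_inverse mult.commute[of _ "inverse \<mu>"])
  qed
  have lamV: "coeff2 lam b c \<in> V" for b c
  proof -
    have "coeff2 (tail l) b c / \<mu> \<in> V"
      by (rule \<mu>(3)) (auto simp: S_def)
    then show ?thesis
      by (simp add: lam_def divide_inverse mult.commute[of _ "inverse \<mu>"])
  qed
  have \<tau>V: "\<tau> \<in> V"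
    using \<mu>(3)[of t] by (simp add: S_def \<tau>_def)
  have fg: "coeff2 f1 b c = \<mu> * coeff2 g b c" if "c \<noteq> 0" for b c
    using that \<mu>(2) by (simp add: g_def coeff2_tail)
  have ll: "coeff2 l b c = \<mu> * coeff2 lam b c" if "c \<noteq> 0" for b c
    using that \<mu>(2) by (simp add: lam_def coeff2_tail)
  have e_negl: "negligible (e f1)"
  proof -
    have "negligible (dx f1)" "negligible (dy f1)"
      unfolding negligible_def coeff2_dx coeff2_dy using dar(2)
      by (auto intro!: of_nat_mult_in_M simp del: of_nat_Suc)
    then show ?thesis
      unfolding e_def by (intro negligible_add negligible_mult z)
  qed
  \<comment> \<open>In \<open>l f1 / \<mu>\<close> the terms with \<open>j = 0\<close> pair a
    coefficient of \<open>l\<close> in \<open>M\<close> with one of \<open>g\<close>; the others,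
    except the one kept, pair \<open>lam\<close> with a nonconstant coefficient of
    \<open>f1\<close>, in \<open>M\<close>. The perturbation contributes \<open>\<tau>\<close> times
    a coefficient of \<open>e f1\<close>, in \<open>M\<close> because \<open>f1\<close> is constant
    modulo \<open>M\<close>.\<close>
  have key: "coeff2 (shamsuddin m f1) b c / \<mu> - coeff2 lam b c * coeff2 f1 0 0 \<in> M"
    if c: "c \<noteq> 0" for b c
  proof -
    define I where "I = {..b} \<times> {..c}"
    define h where "h = (\<lambda>(i, j). coeff2 l i j * coeff2 f1 (b - i) (c - j))"
    have "h x / \<mu> \<in> M" if x: "x \<in> I - {(b, c)}" for x
    proof -
      obtain i j where ij: "x = (i, j)" by (cases x)
      show ?thesis
      proof (cases "j = 0")
        case True
        have "coeff2 l i 0 * coeff2 g (b - i) c \<in> M"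
          using dar(1) gV by (intro M_mult') (auto simp: negligible_def)
        then show ?thesis
          using fg[OF c, of "b - i"] \<mu>(2) True by (simp add: h_def ij)
      next
        case False
        have "(b - i, c - j) \<noteq> (0, 0)"
          using x by (auto simp: ij I_def)
        then have "coeff2 lam i j * coeff2 f1 (b - i) (c - j) \<in> M"
          using lamV dar(2) by (intro M_mult) auto
        then show ?thesis
          using ll[OF False, of i] \<mu>(2) by (simp add: h_def ij)
      qed
    qed
    then have rest: "sum h (I - {(b, c)}) / \<mu> \<in> M"
      unfolding sum_divide_distrib by (rule M_sum)
    have "coeff2 (l * f1) b c = sum h I"
      by (simp add: coeff2_mult I_def h_def sum.cartesian_product)
    also have "\<dots> = h (b, c) + sum h (I - {(b, c)})"
      by (rule sum.remove) (auto simp: I_def)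
    finally have "coeff2 (shamsuddin m f1) b c + t * coeff2 (e f1) b c =
        \<mu> * coeff2 lam b c * coeff2 f1 0 0 + sum h (I - {(b, c)})"
      using eq1 ll[OF c] by (simp add: h_def flip: coeff2_add coeff2_const_mult)
    then have "coeff2 (shamsuddin m f1) b c / \<mu> - coeff2 lam b c * coeff2 f1 0 0 =
        sum h (I - {(b, c)}) / \<mu> - \<tau> * coeff2 (e f1) b c"
      using \<mu>(2) by (simp add: \<tau>_def field_simps)
    also have "\<dots> \<in> M"
      using rest e_negl \<tau>V by (intro M_diff M_mult) (auto simp: negligible_def)
    finally show ?thesis .
  qed
  have g: "negligible g"
  proof (rule ccontr)
    assume "\<not> negligible g"
    then obtain b s where lead: "leading g b s"
      using exists_leading by blast
    note beyond = leading_beyond[OF lead]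
    have s: "s \<noteq> 0"
    proof
      assume "s = 0"
      then have "coeff2 g b s = 0" by (simp add: g_def coeff2_tail)
      then show False using lead by (simp add: leading_def)
    qed
    \<comment> \<open>As \<open>k s \<ge> 2\<close>, the monomial \<open>x^(b+m) y^s\<close> exceeds
      the weight bound \<open>m + 1\<close> of the cofactor. So nothing balances the image of the
      leading term of \<open>g\<close> under \<open>x^m y d/dy\<close>.\<close>
    have "coeff2 lam (b + m) s = 0"
    proof -
      have "k * s \<ge> 2"
        using k(1) s by (metis One_nat_def Suc_leI mult_le_mono mult_1_right neq0_conv)
      then show ?thesis
        using degree_l[of "b + m" s] by (auto simp: lam_def coeff2_tail)
    qed
    then have "coeff2 (shamsuddin m f1) (b + m) s / \<mu> \<in> M"
      using key[OF s, of "b + m"] by simp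
    moreover have "coeff2 (shamsuddin m f1) (b + m) s / \<mu> = of_nat (Suc (b + m)) * coeff2 g (Suc (b + m)) s +
        of_nat s * coeff2 g b s + of_nat (Suc s) * coeff2 g (b + m) (Suc s)"
      using s \<mu>(2) by (simp add: coeff2_shamsuddin fg add_divide_distrib del: of_nat_Suc)
    moreover have "of_nat (Suc (b + m)) * coeff2 g (Suc (b + m)) s \<in> M"
      "of_nat (Suc s) * coeff2 g (b + m) (Suc s) \<in> M"
      by (intro of_nat_mult_in_M beyond; simp)+
    ultimately have "of_nat s * coeff2 g b s \<in> M"
      by (metis M_diff add_diff_cancel_right' add_diff_cancel_left')
    then show False
      using of_nat_mult_notin_M[of s "coeff2 g b s"] s lead gV by (auto simp: leading_def)
  qed
  have lam: "coeff2 lam b c \<in> M" for b c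
  proof (cases "c = 0")
    case False
    have "coeff2 (shamsuddin m f1) b c / \<mu> = of_nat (Suc b) * coeff2 g (Suc b) c +
        (if m \<le> b then of_nat c * coeff2 g (b - m) c else 0) + of_nat (Suc c) * coeff2 g b (Suc c)"
      using False \<mu>(2) by (simp add: coeff2_shamsuddin fg add_divide_distrib del: of_nat_Suc)
    also have "\<dots> \<in> M"
      using g by (auto simp: negligible_def simp del: of_nat_Suc intro!: M_add of_nat_mult_in_M)
    finally have "coeff2 lam b c * coeff2 f1 0 0 \<in> M"
      using key[OF False, of b] M_diff by fastforce
    then show ?thesis
      using M_prime[OF lamV f1V] dar(3) by blast
  qed (simp add: lam_def coeff2_tail)
  \<comment> \<open>The prescribed coefficient \<open>n t\<close> of the cofactor links the
    perturbation to \<open>lam\<close> and forces \<open>\<tau>\<close> into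
    \<open>M\<close>.\<close>
  have "of_nat n * \<tau> = coeff2 lam (m + 1 - k) 1"
    using top_l by (simp add: lam_def coeff2_tail \<tau>_def divide_inverse)
  then have \<tau>: "\<tau> \<in> M"
    using of_nat_mult_notin_M[of n \<tau>] n \<tau>V lam by auto
  \<comment> \<open>\<open>\<mu>\<close> is itself one of the rescaled elements, and its quotient is
    1.\<close>
  have "1 \<in> M"
    using \<mu>(1) unfolding S_def
  proof (elim insertE UnE CollectE exE conjE)
    assume "\<mu> = t"
    then show ?thesis using \<tau> \<mu>(2) by (simp add: \<tau>_def)
  next
    fix b c assume "\<mu> = coeff2 (tail f1) b c"
    then have "coeff2 g b c = 1"
      using \<mu>(2) by (simp add: g_def)
    then show ?thesis using g by (metis negligible_def)
  next
    fix b c assume "\<mu> = coeff2 (tail l) b c"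
    then have "coeff2 lam b c = 1"
      using \<mu>(2) by (simp add: lam_def)
    then show ?thesis using lam by metis
  qed
  then show False by simp
qed

end

section \<open>Polynomials in three variables\<close>

text \<open>The outermost variable is \<open>x0\<close>, the innermost one \<open>x2\<close>.\<close>

type_synonym poly3 = "complex poly poly poly"

definition cpoly_of :: "poly3 \<Rightarrow> cpoly" where
  "cpoly_of P = (\<lambda>(a, b, c). coeff2 (coeff P a) b c)"

lemma cpoly_of_apply [simp]: "cpoly_of P (a, b, c) = coeff2 (coeff P a) b c"
  by (simp add: cpoly_of_def)

lemma cpoly_of_inject [simp]: "cpoly_of P = cpoly_of Q \<longleftrightarrow> P = Q"
proof
  assume *: "cpoly_of P = cpoly_of Q"
  then have "coeff2 (coeff P a) b c = coeff2 (coeff Q a) b c" for a b c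
  proof -
    have "cpoly_of P (a, b, c) = cpoly_of Q (a, b, c)"
      by (simp only: *)
    then show ?thesis
      by (simp only: cpoly_of_apply)
  qed
  then show "P = Q"
    by (metis poly_eqI coeff2_eqI)
qed simp

lemma cpoly_of_0 [simp]: "cpoly_of 0 = (\<lambda>m. 0)"
  by (auto simp: cpoly_of_def)

lemma cpoly_of_add: "cpoly_of (P + Q) m = cpoly_of P m + cpoly_of Q m"
  by (cases m) simp

lemma is_poly_cpoly_of [simp]: "is_poly (cpoly_of P)"
  unfolding is_poly_def
proof (rule finite_subset)
  show "{m. cpoly_of P m \<noteq> 0} \<subseteq> (SIGMA a:{..degree P}. {(b, c). coeff2 (coeff P a) b c \<noteq> 0})"
    by (auto intro!: le_degree)
qed (auto intro: finite_coeff2)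

lemma cpoly_of_sum: "cpoly_of (sum f S) m = (\<Sum>s\<in>S. cpoly_of (f s) m)"
  by (induction S rule: infinite_finite_induct) (auto simp: cpoly_of_add)

lemma is_polyE:
  assumes "is_poly p"
  obtains P where "p = cpoly_of P"
proof
  define mon where "mon = (\<lambda>(a, b, c). monom (monom (monom (p (a, b, c)) c) b) a)"
  have mon: "cpoly_of (mon s) m = (if s = m then p m else 0)" for s m
    by (cases s; cases m) (simp add: mon_def coeff2_def coeff_monom)
  show "p = cpoly_of (sum mon {m. p m \<noteq> 0})"
  proof
    fix m
    have "cpoly_of (sum mon {m. p m \<noteq> 0}) m = (\<Sum>s\<in>{m. p m \<noteq> 0}. if s = m then p m else 0)"
      unfolding cpoly_of_sum mon ..
    also have "\<dots> = p m"
      using assms unfolding is_poly_def by (subst sum.delta) auto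
    finally show "p m = cpoly_of (sum mon {m. p m \<noteq> 0}) m" ..
  qed
qed

lemma pmult_cpoly_of [simp]: "pmult (cpoly_of P) (cpoly_of Q) = cpoly_of (P * Q)"
  by (auto simp: pmult_def fun_eq_iff coeff_mult coeff2_def coeff_sum)

lemma psub_cpoly_of [simp]: "psub (cpoly_of P) (cpoly_of Q) = cpoly_of (P - Q)"
  by (auto simp: psub_def fun_eq_iff)

lemma padd_cpoly_of [simp]: "padd (cpoly_of P) (cpoly_of Q) = cpoly_of (P + Q)"
  by (auto simp: padd_def fun_eq_iff)

lemma d0_cpoly_of [simp]: "d0 (cpoly_of P) = cpoly_of (pderiv P)"
  by (auto simp: d0_def fun_eq_iff coeff_pderiv coeff2_def of_nat_poly simp del: of_nat_Suc)

lemma d1_cpoly_of [simp]: "d1 (cpoly_of P) = cpoly_of (map_poly dx P)"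
  by (auto simp: d1_def fun_eq_iff coeff_map_poly coeff2_dx)

lemma d2_cpoly_of [simp]: "d2 (cpoly_of P) = cpoly_of (map_poly dy P)"
  by (auto simp: d2_def fun_eq_iff coeff_map_poly coeff2_dy)

section \<open>Variables, radial contraction and invariance for nested polynomials\<close>

definition X0 :: poly3 where "X0 = [:0, 1:]"
definition X1 :: poly3 where "X1 = [:[:0, 1:]:]"
definition X2 :: poly3 where "X2 = [:[:[:0, 1:]:]:]"
definition const3 :: "complex \<Rightarrow> poly3" where "const3 c = [:const2 c:]"

lemma coeff_X0 [simp]: "coeff2 (coeff (X0 * P) a) b c = (if a = 0 then 0 else coeff2 (coeff P (a - 1)) b c)"
  by (cases a) (auto simp: X0_def)

lemma coeff_X1 [simp]: "coeff2 (coeff (X1 * P) a) b c = (if b = 0 then 0 else coeff2 (coeff P a) (b - 1) c)"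
  by (cases b) (auto simp: X1_def coeff2_def)

lemma coeff_X2 [simp]: "coeff2 (coeff (X2 * P) a) b c = (if c = 0 then 0 else coeff2 (coeff P a) b (c - 1))"
  by (cases c) (auto simp: X2_def coeff2_def)

lemma coeff_const3 [simp]: "coeff2 (coeff (const3 t * P) a) b c = t * coeff2 (coeff P a) b c"
  by (simp add: const3_def)

lemma var0_eq: "var0 = cpoly_of X0"
  by (auto simp: var0_def X0_def cpoly_of_def coeff2_def coeff_pCons fun_eq_iff split: nat.split)

lemma var1_eq: "var1 = cpoly_of X1"
  by (auto simp: var1_def X1_def cpoly_of_def coeff2_def coeff_pCons fun_eq_iff split: nat.split)

lemma var2_eq: "var2 = cpoly_of X2"
  by (auto simp: var2_def X2_def cpoly_of_def coeff2_def coeff_pCons fun_eq_iff split: nat.split)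

lemma pconst_eq: "pconst c = cpoly_of (const3 c)"
  by (auto simp: pconst_def const3_def const2_def cpoly_of_def coeff2_def coeff_pCons fun_eq_iff split: nat.split)

lemma contract_R_cpoly_of:
  "contract_R k (cpoly_of A0, cpoly_of A1, cpoly_of A2) =
     cpoly_of (X0 * A0 + X1 * A1 + const3 (of_nat k) * (X2 * A2))"
  by (simp add: contract_R_def var0_eq var1_eq var2_eq pconst_eq)

lemma qdeg_eq [simp]: "qdeg k (a, b, c) = int (a + b + k * c)"
  by (simp add: qdeg_def)

lemma quasi_homD:
  "quasi_hom k n (cpoly_of P) \<Longrightarrow> coeff2 (coeff P a) b c \<noteq> 0 \<Longrightarrow> int (a + b + k * c) = n"
  by (auto simp: quasi_hom_def simp del: of_nat_add dest!: spec[of _ "(a, b, c)"])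

lemma FolSpaceE:
  assumes "w \<in> FolSpace k d"
  obtains A0 A1 A2 where "w = (cpoly_of A0, cpoly_of A1, cpoly_of A2)"
    "quasi_hom k (int d - 1) (cpoly_of A0)" "quasi_hom k (int d - 1) (cpoly_of A1)"
    "quasi_hom k (int d - int k) (cpoly_of A2)"
    "X0 * A0 + X1 * A1 + const3 (of_nat k) * (X2 * A2) = 0"
proof -
  obtain p0 p1 p2 where w: "w = (p0, p1, p2)" by (cases w)
  have q: "quasi_hom k (int d - 1) p0" "quasi_hom k (int d - 1) p1" "quasi_hom k (int d - int k) p2"
    and R: "contract_R k (p0, p1, p2) = (\<lambda>m. 0)"
    using assms by (auto simp: FolSpace_def w)
  obtain A0 A1 A2 where A: "p0 = cpoly_of A0" "p1 = cpoly_of A1" "p2 = cpoly_of A2"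
    using q by (auto simp: quasi_hom_def elim!: is_polyE)
  show thesis
  proof (rule that)
    show "w = (cpoly_of A0, cpoly_of A1, cpoly_of A2)" using w A by simp
    have "cpoly_of (X0 * A0 + X1 * A1 + const3 (of_nat k) * (X2 * A2)) = cpoly_of 0"
      using R unfolding A contract_R_cpoly_of by simp
    then show "X0 * A0 + X1 * A1 + const3 (of_nat k) * (X2 * A2) = 0"
      by (simp only: cpoly_of_inject)
  qed (use q A in auto)
qed

lemma invariant_curve_cpoly_of:
  "invariant_curve (cpoly_of A0, cpoly_of A1, cpoly_of A2) (cpoly_of F) \<longleftrightarrow>
    (\<exists>T01 T02 T12. A0 * map_poly dx F - A1 * pderiv F = F * T01 \<and>
       A0 * map_poly dy F - A2 * pderiv F = F * T02 \<and>
       A1 * map_poly dy F - A2 * map_poly dx F = F * T12)" (is "?L \<longleftrightarrow> ?R")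
proof
  assume ?L
  then obtain T01 T02 T12 where T: "is_poly T01" "is_poly T02" "is_poly T12"
      "cpoly_of (A0 * map_poly dx F - A1 * pderiv F) = pmult (cpoly_of F) T01"
      "cpoly_of (A0 * map_poly dy F - A2 * pderiv F) = pmult (cpoly_of F) T02"
      "cpoly_of (A1 * map_poly dy F - A2 * map_poly dx F) = pmult (cpoly_of F) T12"
    by (auto simp: invariant_curve_def)
  obtain Q01 Q02 Q12 where "T01 = cpoly_of Q01" "T02 = cpoly_of Q02" "T12 = cpoly_of Q12"
    using T(1-3) by (auto elim!: is_polyE)
  then show ?R
    using T(4-6) by auto
next
  assume ?R
  then obtain T01 T02 T12 where "A0 * map_poly dx F - A1 * pderiv F = F * T01"
      "A0 * map_poly dy F - A2 * pderiv F = F * T02"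
      "A1 * map_poly dy F - A2 * map_poly dx F = F * T12"
    by blast
  then show ?L
    unfolding invariant_curve_def prod.case
    by (intro exI[of _ "cpoly_of T01"] exI[of _ "cpoly_of T02"] exI[of _ "cpoly_of T12"]) simp
qed

section \<open>Lines and binary forms\<close>

lemma X0_dvd_iff: "X0 dvd P \<longleftrightarrow> coeff P 0 = 0"
proof
  assume "coeff P 0 = 0"
  then have "P = X0 * poly_shift 1 P"
    by (intro poly_eqI) (auto simp: X0_def coeff_pCons coeff_poly_shift split: nat.split)
  then show "X0 dvd P" by (rule dvdI)
qed (auto simp: X0_def)

lemma X0_deriv: "pderiv X0 = 1" "map_poly dx X0 = 0" "map_poly dy X0 = 0"
proof -
  have "dy (1 :: complex poly poly) = 0"
    by (simp add: one_pCons map_poly_pCons)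
  then show "map_poly dy X0 = 0"
    by (simp add: X0_def map_poly_pCons)
qed (simp_all add: X0_def map_poly_pCons pderiv_pCons)

lemma alg_curve_X0: "alg_curve_poly k (cpoly_of X0)"
  unfolding alg_curve_poly_def var0_eq[symmetric]
proof
  have "is_poly var0"
    unfolding var0_eq by simp
  then have "quasi_hom k 1 var0"
    by (auto simp: quasi_hom_def var0_def split: if_splits)
  then show "\<exists>n. quasi_hom k n var0" ..
  show "\<exists>m. m \<noteq> (0, 0, 0) \<and> var0 m \<noteq> 0"
    by (intro exI[of _ "(1, 0, 0)"]) (simp add: var0_def)
qed

lemma alg_curve_line: "alg_curve_poly k (cpoly_of (X1 - const3 r * X0))"
proof -
  have c: "cpoly_of (X1 - const3 r * X0) m = (if m = (0, 1, 0) then 1 else if m = (1, 0, 0) then - r else 0)" for m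
    by (cases m) (auto simp: X0_def X1_def const3_def const2_def coeff2_def coeff_pCons split: nat.split)
  have "quasi_hom k 1 (cpoly_of (X1 - const3 r * X0))"
    unfolding quasi_hom_def by (auto simp: c split: if_splits)
  moreover have "cpoly_of (X1 - const3 r * X0) (0, 1, 0) \<noteq> 0"
    unfolding c by simp
  ultimately show ?thesis
    unfolding alg_curve_poly_def by (auto intro!: exI[of _ "(0, 1, 0)"])
qed

lemma const3_simps:
  "const3 (r * s) = const3 r * const3 s" "const3 1 = 1" "const3 (- r) = - const3 r"
  by (auto simp: const3_def const2_def one_pCons)

lemma const3_power: "const3 (r ^ n) = const3 r ^ n"
  by (induction n) (auto simp: const3_simps)

lemma coeff_monomial3:
  "coeff2 (coeff (const3 t * (X0 ^ i * (X1 ^ j * X2 ^ l))) a) b c = (if (a, b, c) = (i, j, l) then t else 0)"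
proof -
  have "X0 ^ i = monom 1 i" "X1 ^ j = [:monom 1 j:]" "X2 ^ l = [:[:monom 1 l:]:]" for i j l
    unfolding X0_def X1_def X2_def by (simp_all add: monom_altdef poly_const_pow)
  then have "const3 t * (X0 ^ i * (X1 ^ j * X2 ^ l)) = monom (monom (monom t l) j) i"
    by (simp add: const3_def const2_def smult_monom mult.commute)
  then show ?thesis
    by (simp add: coeff2_def coeff_monom)
qed

lemma binary_form_eq:
  assumes "\<And>a b c. coeff2 (coeff P a) b c \<noteq> 0 \<Longrightarrow> c = 0 \<and> a + b = e"
  shows "(\<Sum>j\<le>e. const3 (coeff2 (coeff P (e - j)) j 0) * (X0 ^ (e - j) * X1 ^ j)) = P"
proof (rule cpoly_of_inject[THEN iffD1], rule ext, clarify)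
  fix a b c
  have "cpoly_of (\<Sum>j\<le>e. const3 (coeff2 (coeff P (e - j)) j 0) * (X0 ^ (e - j) * X1 ^ j)) (a, b, c)
      = (\<Sum>j\<le>e. coeff2 (coeff (const3 (coeff2 (coeff P (e - j)) j 0) * (X0 ^ (e - j) * (X1 ^ j * X2 ^ 0))) a) b c)"
    unfolding cpoly_of_sum by (simp only: cpoly_of_apply power_0 mult_1_right)
  also have "\<dots> = (\<Sum>j\<le>e. if j = b then (if a = e - b \<and> c = 0 then coeff2 (coeff P a) b c else 0) else 0)"
    unfolding coeff_monomial3 by (intro sum.cong) auto
  also have "\<dots> = cpoly_of P (a, b, c)"
    using assms[of a b c] by (cases "coeff2 (coeff P a) b c = 0") auto
  finally show "cpoly_of (\<Sum>j\<le>e. const3 (coeff2 (coeff P (e - j)) j 0) * (X0 ^ (e - j) * X1 ^ j)) (a, b, c)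
      = cpoly_of P (a, b, c)" .
qed

text \<open>Setting \<open>x0 = 1\<close> gives the polynomial \<open>G\<close>, nonconstant because
  of its coefficient at \<open>e\<close>, so it has a root \<open>r\<close>. Modulo
  \<open>x1 - r x0\<close> each \<open>x1^j\<close> becomes \<open>(r x0)^j\<close>, and the form
  becomes \<open>G(r) x0^e = 0\<close>.\<close>

lemma binary_form_linear_factor:
  assumes P: "\<And>a b c. coeff2 (coeff P a) b c \<noteq> 0 \<Longrightarrow> c = 0 \<and> a + b = e"
    and e: "e > 0" "coeff2 (coeff P 0) e 0 \<noteq> 0"
  shows "\<exists>r. (X1 - const3 r * X0) dvd P"
proof -
  define g where "g j = coeff2 (coeff P (e - j)) j 0" for j
  define G where "G = (\<Sum>j\<le>e. monom (g j) j)"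
  have "coeff G e = g e"
    by (simp add: G_def coeff_sum coeff_monom)
  then have "degree G \<ge> e"
    using e by (intro le_degree) (simp add: g_def)
  then have "\<not> constant (poly G)"
    using e by (simp add: constant_degree)
  then obtain r where r: "poly G r = 0"
    using fundamental_theorem_of_algebra by blast
  have "(X1 - const3 r * X0) dvd const3 (g j) * (X0 ^ (e - j) * X1 ^ j) - const3 (g j * r ^ j) * X0 ^ e" if "j \<le> e" for j
  proof -
    have "X0 ^ e = X0 ^ (e - j) * X0 ^ j"
      using that by (simp flip: power_add)
    then have "const3 (g j) * (X0 ^ (e - j) * X1 ^ j) - const3 (g j * r ^ j) * X0 ^ e
        = const3 (g j) * X0 ^ (e - j) * (X1 ^ j - (const3 r * X0) ^ j)"
      by (simp add: const3_simps const3_power power_mult_distrib algebra_simps)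
    moreover have "(X1 - const3 r * X0) dvd X1 ^ j - (const3 r * X0) ^ j"
      by (simp add: power_diff_sumr2)
    ultimately show ?thesis by simp
  qed
  then have "(X1 - const3 r * X0) dvd (\<Sum>j\<le>e. const3 (g j) * (X0 ^ (e - j) * X1 ^ j) - const3 (g j * r ^ j) * X0 ^ e)"
    by (intro dvd_sum) auto
  also have "\<dots> = P - const3 (poly G r) * X0 ^ e"
  proof -
    have "const3 (\<Sum>j\<le>e. g j * r ^ j) = (\<Sum>j\<le>e. const3 (g j * r ^ j))"
      by (simp add: const3_def const2_def sum_to_poly)
    then show ?thesis
      using binary_form_eq[of P e, OF P, folded g_def]
      by (simp add: sum_subtractf G_def poly_sum poly_monom sum_distrib_right)
  qed
  finally show ?thesis
    using r by (auto simp: const3_def const2_def)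
qed

section \<open>Small degree\<close>

lemma invariant_curve_small_degree:
  assumes k: "k \<ge> 2" and d: "d < 2 * k + 1" and w: "w \<in> FolSpace k d"
  shows "has_invariant_curve k w"
proof -
  obtain A0 A1 A2 where w: "w = (cpoly_of A0, cpoly_of A1, cpoly_of A2)"
    and q: "quasi_hom k (int d - int k) (cpoly_of A2)"
    and R: "X0 * A0 + X1 * A1 + const3 (of_nat k) * (X2 * A2) = 0"
    by (rule FolSpaceE[OF w])
  have R_coeff: "(if a = 0 then 0 else coeff2 (coeff A0 (a - 1)) b c) +
      (if b = 0 then 0 else coeff2 (coeff A1 a) (b - 1) c) +
      of_nat k * (if c = 0 then 0 else coeff2 (coeff A2 a) b (c - 1)) = 0" for a b c
    using arg_cong[OF R, of "\<lambda>P. coeff2 (coeff P a) b c"] by simp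
  \<comment> \<open>Pure powers of \<open>x2\<close> in the contraction can only come from
    \<open>k x2 A2\<close>.\<close>
  have corner: "coeff2 (coeff A2 0) 0 c = 0" for c
    using R_coeff[of 0 0 "Suc c"] k by simp
  \<comment> \<open>A monomial containing \<open>x2\<close> and another variable weighs at least
    \<open>k + 1\<close>, which exceeds \<open>d - k\<close>.\<close>
  have A2: "c = 0 \<and> a + b = d - k \<and> d > k" if nz: "coeff2 (coeff A2 a) b c \<noteq> 0" for a b c
  proof -
    have deg: "a + b + k * c + k = d"
      using quasi_homD[OF q nz] by linarith
    have ab: "a + b > 0"
      using nz corner by (cases a; cases b) auto
    have "c = 0"
    proof (rule ccontr)
      assume "c \<noteq> 0"
      then have "k * c \<ge> k" by simp
      then show False using deg ab d by linarith
    qed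
    then show ?thesis using deg ab by auto
  qed
  show ?thesis
  proof (cases "coeff2 (coeff A2 0) (d - k) 0 = 0")
    case True
    have "coeff A2 0 = 0"
    proof (rule coeff2_eqI)
      fix b c show "coeff2 (coeff A2 0) b c = coeff2 0 b c"
        using A2[of 0 b c] True by auto
    qed
    \<comment> \<open>On \<open>x0 = 0\<close> the contraction now reduces to
      \<open>x1 A1 = 0\<close>.\<close>
    moreover have "coeff A1 0 = 0"
    proof (rule coeff2_eqI)
      fix b c show "coeff2 (coeff A1 0) b c = coeff2 0 b c"
        using R_coeff[of 0 "Suc b" c] \<open>coeff A2 0 = 0\<close> by (simp split: if_splits)
    qed
    ultimately obtain B1 B2 where B: "A1 = X0 * B1" "A2 = X0 * B2"
      using X0_dvd_iff[of A1] X0_dvd_iff[of A2] by (auto elim!: dvdE)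
    have "invariant_curve w (cpoly_of X0)"
      unfolding w invariant_curve_cpoly_of
      by (rule exI[of _ "- B1"], rule exI[of _ "- B2"], rule exI[of _ 0], simp add: X0_deriv B mult.commute)
    then show ?thesis
      using alg_curve_X0 unfolding has_invariant_curve_def by blast
  next
    case False
    then have e: "d - k > 0"
      using A2 by fastforce
    obtain r where "(X1 - const3 r * X0) dvd A2"
      using binary_form_linear_factor[OF _ e False] A2 by blast
    then obtain B where B: "A2 = (X1 - const3 r * X0) * B" by (rule dvdE)
    let ?F = "X1 - const3 r * X0"
    \<comment> \<open>The contraction is regrouped around the linear factor. Since \<open>x0\<close>
      is prime to it, \<open>A0 + r A1\<close> becomes a multiple of \<open>?F\<close>; this
      combination is the \<open>dx0 \<and> dx1\<close> component of
      \<open>\<omega> \<and> dF\<close>.\<close>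
    have "X0 * (A0 + const3 r * A1) + ?F * (A1 + const3 (of_nat k) * X2 * B) =
        X0 * A0 + X1 * A1 + const3 (of_nat k) * (X2 * A2)"
      unfolding B by (simp add: algebra_simps)
    then have eq: "X0 * (A0 + const3 r * A1) = - (?F * (A1 + const3 (of_nat k) * X2 * B))"
      using R by (simp only: eq_neg_iff_add_eq_0)
    then have "X0 dvd ?F * (A1 + const3 (of_nat k) * X2 * B)"
      using dvd_triv_left[of X0 "A0 + const3 r * A1"] by simp
    moreover have "coeff ?F 0 \<noteq> 0"
      by (simp add: X0_def X1_def coeff_mult)
    ultimately have "X0 dvd A1 + const3 (of_nat k) * X2 * B"
      unfolding X0_dvd_iff coeff_mult_0 by simp
    then obtain C where C: "A1 + const3 (of_nat k) * X2 * B = X0 * C" by (rule dvdE)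
    have "X0 * (A0 + const3 r * A1) = X0 * (?F * (- C))"
      unfolding eq C by (simp only: mult_minus_right mult.left_commute)
    moreover have "X0 \<noteq> 0"
      by (simp add: X0_def)
    ultimately have A01: "A0 + const3 r * A1 = ?F * (- C)"
      using mult_left_cancel by blast
    have F: "pderiv ?F = - const3 r" "map_poly dx ?F = 1" "map_poly dy ?F = 0"
      by (simp_all add: X0_def X1_def const3_def const2_def pderiv_pCons map_poly_pCons one_pCons)
    have "A0 * 1 - A1 * (- const3 r) = ?F * (- C)"
      using A01 by (simp add: mult.commute)
    moreover have "A0 * 0 - A2 * (- const3 r) = ?F * (const3 r * B)"
      "A1 * 0 - A2 * 1 = ?F * (- B)"
      unfolding B by (simp_all add: mult.commute mult.left_commute)
    ultimately have "invariant_curve w (cpoly_of ?F)"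
      unfolding w invariant_curve_cpoly_of F by blast
    then show ?thesis
      using alg_curve_line unfolding has_invariant_curve_def by blast
  qed
qed

section \<open>Quasi-homogeneous polynomials\<close>

definition component :: "nat \<Rightarrow> int \<Rightarrow> cpoly \<Rightarrow> cpoly" where
  "component k n p = (\<lambda>m. if qdeg k m = n then p m else 0)"

lemma is_poly_component: "is_poly p \<Longrightarrow> is_poly (component k n p)"
  unfolding is_poly_def component_def by (erule rev_finite_subset) auto

lemma quasi_hom_iff_component: "quasi_hom k n p \<longleftrightarrow> is_poly p \<and> component k n p = p"
  unfolding quasi_hom_def component_def fun_eq_iff by auto

lemma quasi_hom_component: "is_poly p \<Longrightarrow> quasi_hom k n (component k n p)"
  by (simp add: quasi_hom_iff_component is_poly_component) (auto simp: component_def)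

text \<open>Multiplication by \<open>p\<close> shifts every weight by \<open>n\<close>, so it
  commutes with the grading. This allows a cofactor to be replaced by one of its components.\<close>

lemma pmult_component:
  assumes "quasi_hom k n p"
  shows "pmult p (component k N q) = component k (n + N) (pmult p q)"
proof (rule ext, clarify)
  fix a b c
  have summand: "p (i, j, l) * component k N q (a - i, b - j, c - l) =
      (if qdeg k (a, b, c) = n + N then p (i, j, l) * q (a - i, b - j, c - l) else 0)"
    if "i \<le> a" "j \<le> b" "l \<le> c" for i j l
  proof (cases "p (i, j, l) = 0")
    case False
    then have n: "qdeg k (i, j, l) = n"
      using assms by (simp add: quasi_hom_def)
    have "qdeg k (a - i, b - j, c - l) = qdeg k (a, b, c) - n"
      using that by (simp add: of_nat_diff right_diff_distrib flip: n)
    then show ?thesis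
      by (auto simp: component_def simp del: qdeg_eq)
  qed simp
  show "pmult p (component k N q) (a, b, c) = component k (n + N) (pmult p q) (a, b, c)"
  proof (cases "qdeg k (a, b, c) = n + N")
    case True
    then show ?thesis
      unfolding pmult_def component_def[of k "n + N"] prod.case by (auto intro!: sum.cong simp: summand)
  next
    case False
    then show ?thesis
      unfolding pmult_def component_def[of k "n + N"] prod.case by (auto intro!: sum.neutral simp: summand)
  qed
qed

lemma is_poly_pmult: "is_poly p \<Longrightarrow> is_poly q \<Longrightarrow> is_poly (pmult p q)"
  by (auto elim!: is_polyE)

lemma quasi_hom_pmult:
  assumes "quasi_hom k n p" "quasi_hom k n' q"
  shows "quasi_hom k (n + n') (pmult p q)"
  using pmult_component[OF assms(1), of n' q] assms is_poly_pmult
  unfolding quasi_hom_iff_component by simp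

lemma quasi_hom_psub:
  assumes "quasi_hom k n p" "quasi_hom k n q"
  shows "quasi_hom k n (psub p q)"
proof -
  have "is_poly (psub p q)"
    using assms by (auto simp: quasi_hom_def elim!: is_polyE)
  moreover have "qdeg k m = n" if "psub p q m \<noteq> 0" for m
  proof -
    have "p m \<noteq> 0 \<or> q m \<noteq> 0"
      using that by (auto simp: psub_def)
    then show ?thesis
      using assms unfolding quasi_hom_def by blast
  qed
  ultimately show ?thesis
    by (simp only: quasi_hom_def) blast
qed

lemma quasi_hom_d1:
  assumes "quasi_hom k n (cpoly_of P)"
  shows "quasi_hom k (n - 1) (cpoly_of (map_poly dx P))"
  unfolding quasi_hom_def
proof (intro conjI allI impI)
  fix m assume m: "cpoly_of (map_poly dx P) m \<noteq> 0"
  obtain a b c where abc: "m = (a, b, c)" by (cases m)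
  then have "coeff2 (coeff P a) (Suc b) c \<noteq> 0"
    using m by (auto simp: coeff_map_poly coeff2_dx)
  from quasi_homD[OF assms this] show "qdeg k m = n - 1"
    by (simp add: abc)
qed simp

lemma quasi_hom_d2:
  assumes "quasi_hom k n (cpoly_of P)"
  shows "quasi_hom k (n - int k) (cpoly_of (map_poly dy P))"
  unfolding quasi_hom_def
proof (intro conjI allI impI)
  fix m assume m: "cpoly_of (map_poly dy P) m \<noteq> 0"
  obtain a b c where abc: "m = (a, b, c)" by (cases m)
  then have "coeff2 (coeff P a) b (Suc c) \<noteq> 0"
    using m by (auto simp: coeff_map_poly coeff2_dy)
  from quasi_homD[OF assms this] show "qdeg k m = n - int k"
    by (simp add: abc algebra_simps)
qed simp

section \<open>Euler's formula and the affine chart \<open>x0 = 1\<close>\<close>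

lemma coeff2_pderiv_outer: "coeff2 (coeff (pderiv P) a) b c = of_nat (Suc a) * coeff2 (coeff P (Suc a)) b c"
  for P :: poly3
  by (simp add: coeff_pderiv coeff2_def of_nat_poly del: of_nat_Suc)

lemma euler:
  assumes "quasi_hom k (int n) (cpoly_of F)"
  shows "X0 * pderiv F + X1 * map_poly dx F + const3 (of_nat k) * (X2 * map_poly dy F) = const3 (of_nat n) * F"
proof (rule cpoly_of_inject[THEN iffD1], rule ext, clarify)
  fix a b c
  have "coeff2 (coeff (X0 * pderiv F + X1 * map_poly dx F + const3 (of_nat k) * (X2 * map_poly dy F)) a) b c =
      of_nat (a + b + k * c) * coeff2 (coeff F a) b c"
  proof -
    have "coeff2 (coeff (X0 * pderiv F) a) b c = of_nat a * coeff2 (coeff F a) b c"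
      by (cases a) (simp_all add: coeff2_pderiv_outer del: of_nat_Suc)
    moreover have "coeff2 (coeff (X1 * map_poly dx F) a) b c = of_nat b * coeff2 (coeff F a) b c"
      by (cases b) (simp_all add: coeff_map_poly coeff2_dx del: of_nat_Suc)
    moreover have "coeff2 (coeff (X2 * map_poly dy F) a) b c = of_nat c * coeff2 (coeff F a) b c"
      by (cases c) (simp_all add: coeff_map_poly coeff2_dy del: of_nat_Suc)
    ultimately show ?thesis
      by (simp del: coeff_X0 coeff_X1 coeff_X2 add: distrib_right)
  qed
  also have "\<dots> = of_nat n * coeff2 (coeff F a) b c"
  proof (cases "coeff2 (coeff F a) b c = 0")
    case False
    then have "a + b + k * c = n"
      using quasi_homD[OF assms False] by linarith
    then show ?thesis by simp
  qed simp
  finally show "cpoly_of (X0 * pderiv F + X1 * map_poly dx F + const3 (of_nat k) * (X2 * map_poly dy F)) (a, b, c)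
      = cpoly_of (const3 (of_nat n) * F) (a, b, c)"
    by simp
qed

lemma coeff2_poly_1: "coeff2 (poly P 1) b c = (\<Sum>a\<le>degree P. coeff2 (coeff P a) b c)"
  by (simp add: poly_altdef coeff2_def coeff_sum)

text \<open>The weight recovers the exponent of \<open>x0\<close> from the other two, so no two
  monomials merge when \<open>x0\<close> is set to 1.\<close>

lemma dehomogenize_coeff:
  assumes "quasi_hom k (int N) (cpoly_of P)"
  shows "coeff2 (poly P 1) b c = (if b + k * c \<le> N then coeff2 (coeff P (N - (b + k * c))) b c else 0)"
    (is "_ = ?r")
proof -
  have summand: "coeff2 (coeff P a) b c = (if a = N - (b + k * c) then ?r else 0)" for a
  proof (cases "coeff2 (coeff P a) b c = 0")
    case False
    then have "a + b + k * c = N"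
      using quasi_homD[OF assms False] by linarith
    then show ?thesis by auto
  qed auto
  have "coeff2 (poly P 1) b c = (\<Sum>a\<le>degree P. if a = N - (b + k * c) then ?r else 0)"
    unfolding coeff2_poly_1 by (rule sum.cong[OF refl]) (rule summand)
  also have "\<dots> = ?r"
    by (simp add: coeff_eq_0)
  finally show ?thesis .
qed

lemma poly_map_dx: "poly (map_poly dx P) 1 = dx (poly P 1)" for P :: poly3
  by (induction P) (simp_all add: map_poly_pCons pderiv_add)

lemma poly_map_dy: "poly (map_poly dy P) 1 = dy (poly P 1)" for P :: poly3
proof (induction P)
  case (pCons a P)
  have "dy (a + poly P 1) = dy a + dy (poly P 1)"
    by (rule coeff2_eqI) (simp add: coeff2_dy algebra_simps)
  then show ?case
    using pCons by (simp add: map_poly_pCons)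
qed simp

text \<open>Contracting \<open>\<omega> \<and> dF = F \<Theta>\<close> with the radial field gives \<open>i\<^sub>R \<Theta> = - n \<omega>\<close>; its \<open>dx2\<close> component
  determines the cofactor along \<open>x0 = 0\<close>.\<close>

lemma invariant_curve_cofactor:
  assumes k: "quasi_hom k (int d - 1) (cpoly_of A1)" "quasi_hom k (int d - int k) (cpoly_of A2)"
    and R: "X0 * A0 + X1 * A1 + const3 (of_nat k) * (X2 * A2) = 0"
    and F: "quasi_hom k (int n) (cpoly_of F)" "F \<noteq> 0"
    and inv: "invariant_curve (cpoly_of A0, cpoly_of A1, cpoly_of A2) (cpoly_of F)"
  obtains T where "A1 * map_poly dy F - A2 * map_poly dx F = F * T"
    "quasi_hom k (int d - 1 - int k) (cpoly_of T)"
    "\<And>b c. int (b + k * c) = int d - 1 - int k \<Longrightarrow>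
       coeff2 (coeff T 0) b c = - of_nat n * coeff2 (coeff A2 0) (Suc b) c"
proof -
  obtain T01 T02 T12 where T: "A0 * map_poly dy F - A2 * pderiv F = F * T02"
      "A1 * map_poly dy F - A2 * map_poly dx F = F * T12"
    using inv unfolding invariant_curve_cpoly_of by blast
  have "F * (X0 * T02 + X1 * T12 + const3 (of_nat n) * A2) =
      X0 * (F * T02) + X1 * (F * T12) + A2 * (const3 (of_nat n) * F)"
    by (simp add: algebra_simps)
  also have "\<dots> = map_poly dy F * (X0 * A0 + X1 * A1 + const3 (of_nat k) * (X2 * A2))"
    unfolding euler[OF F(1), symmetric] T[symmetric] by (simp add: algebra_simps)
  finally have "X0 * T02 + X1 * T12 + const3 (of_nat n) * A2 = 0"
    using R F(2) by simp
  then have *: "coeff2 (coeff (X0 * T02 + X1 * T12 + const3 (of_nat n) * A2) 0) (Suc b) c = 0" for b c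
    by simp
  \<comment> \<open>\<open>T12\<close> may be inhomogeneous. Its component of the expected weight is
    still a cofactor, because \<open>F\<close> and the left-hand side are quasi-homogeneous.\<close>
  let ?N = "int d - 1 - int k"
  obtain T where compT: "component k ?N (cpoly_of T12) = cpoly_of T"
    by (rule is_polyE[OF is_poly_component[OF is_poly_cpoly_of]])
  show thesis
  proof (rule that)
    let ?G = "cpoly_of (A1 * map_poly dy F - A2 * map_poly dx F)"
    have "quasi_hom k (int n + ?N) ?G"
      using quasi_hom_pmult[OF k(1) quasi_hom_d2[OF F(1)]] quasi_hom_pmult[OF k(2) quasi_hom_d1[OF F(1)]]
      by (simp flip: psub_cpoly_of pmult_cpoly_of add: quasi_hom_psub algebra_simps)
    then have "?G = component k (int n + ?N) (pmult (cpoly_of F) (cpoly_of T12))"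
      by (simp add: quasi_hom_iff_component T(2))
    also have "\<dots> = cpoly_of (F * T)"
      unfolding pmult_component[OF F(1), symmetric] compT by (rule pmult_cpoly_of)
    finally show "A1 * map_poly dy F - A2 * map_poly dx F = F * T"
      by (simp only: cpoly_of_inject)
    show "quasi_hom k ?N (cpoly_of T)"
      unfolding compT[symmetric] by (rule quasi_hom_component) simp
    fix b c assume "int (b + k * c) = ?N"
    then have "coeff2 (coeff T 0) b c = coeff2 (coeff T12 0) b c"
      using fun_cong[OF compT, of "(0, b, c)"] by (simp add: component_def)
    then show "coeff2 (coeff T 0) b c = - of_nat n * coeff2 (coeff A2 0) (Suc b) c"
      using *[of b c] by (simp add: eq_neg_iff_add_eq_0)
  qed
qed

section \<open>The pencil\<close>

text \<open>Coefficients of the pencil \<open>\<omega>\<^sub>0 + \<tau> \<omega>\<^sub>1\<close>, where \<open>m = d - k - 2\<close> and \<open>j = d - 2k - 1\<close>. In the chart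
  \<open>x0 = 1\<close> the foliation \<open>\<omega>\<^sub>0\<close> is given by the derivation \<open>\<partial>\<^sub>x + (x\<^sup>m y + 1)\<partial>\<^sub>y\<close>, and \<open>\<omega>\<^sub>1\<close> breaks
  the invariance of \<open>x0 = 0\<close>.\<close>

definition base_coeff :: "nat \<Rightarrow> nat \<Rightarrow> nat \<Rightarrow> mon \<Rightarrow> complex" where
  "base_coeff k m i s =
    (if i = 0 then
       (if s = (0, m + 1, 1) \<or> s = (m + k, 1, 0) then 1
        else if s = (m + 1, 0, 1) then - of_nat k else 0)
     else if i = 1 then (if s = (1, m, 1) \<or> s = (m + k + 1, 0, 0) then -1 else 0)
     else (if s = (m + 2, 0, 0) then 1 else 0))"

definition perturbation_coeff :: "nat \<Rightarrow> nat \<Rightarrow> nat \<Rightarrow> mon \<Rightarrow> complex" where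
  "perturbation_coeff k j i s =
    (if i = 0 then 0
     else if i = 1 then (if s = (0, j, 2) then - of_nat k else 0)
     else (if s = (0, Suc j, 1) then 1 else 0))"

definition pencil_coeff :: "nat \<Rightarrow> nat \<Rightarrow> nat \<Rightarrow> complex \<Rightarrow> nat \<Rightarrow> cpoly" where
  "pencil_coeff k m j \<tau> i = (\<lambda>s. base_coeff k m i s + \<tau> * perturbation_coeff k j i s)"

definition pencil :: "nat \<Rightarrow> nat \<Rightarrow> nat \<Rightarrow> complex \<Rightarrow> form1" where
  "pencil k m j \<tau> = (pencil_coeff k m j \<tau> 0, pencil_coeff k m j \<tau> 1, pencil_coeff k m j \<tau> 2)"

lemma form_coeff_pencil:
  "form_coeff i s (pencil k m j \<tau>) = base_coeff k m i s + \<tau> * perturbation_coeff k j i s"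
  by (auto simp: form_coeff_def pencil_def pencil_coeff_def base_coeff_def perturbation_coeff_def)

definition monomial3 :: "complex \<Rightarrow> nat \<Rightarrow> nat \<Rightarrow> nat \<Rightarrow> poly3" where
  "monomial3 t i j l = const3 t * (X0 ^ i * (X1 ^ j * X2 ^ l))"

lemma cpoly_of_monomial3: "cpoly_of (monomial3 t i j l) s = (if s = (i, j, l) then t else 0)"
  by (cases s) (simp only: monomial3_def coeff_monomial3 cpoly_of_apply)

lemma pencil_coeff_eq:
  "pencil_coeff k m j \<tau> 0 = cpoly_of (monomial3 1 0 (m + 1) 1 + monomial3 1 (m + k) 1 0 +
     monomial3 (- of_nat k) (m + 1) 0 1)"
  "pencil_coeff k m j \<tau> 1 = cpoly_of (monomial3 (-1) 1 m 1 + monomial3 (-1) (m + k + 1) 0 0 +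
     monomial3 (- of_nat k * \<tau>) 0 j 2)"
  "pencil_coeff k m j \<tau> 2 = cpoly_of (monomial3 1 (m + 2) 0 0 + monomial3 \<tau> 0 (Suc j) 1)"
  by (rule ext; simp only: cpoly_of_add cpoly_of_monomial3 pencil_coeff_def base_coeff_def
      perturbation_coeff_def; simp)+

lemma quasi_hom_monomial3: "int (a + b + k * c) = n \<Longrightarrow> quasi_hom k n (cpoly_of (monomial3 t a b c))"
  by (simp add: quasi_hom_def cpoly_of_monomial3)

lemma quasi_hom_add:
  assumes "quasi_hom k n (cpoly_of P)" "quasi_hom k n (cpoly_of Q)"
  shows "quasi_hom k n (cpoly_of (P + Q))"
proof -
  have "cpoly_of P s \<noteq> 0 \<or> cpoly_of Q s \<noteq> 0" if "cpoly_of (P + Q) s \<noteq> 0" for s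
    using that by (auto simp: cpoly_of_add)
  then show ?thesis
    using assms unfolding quasi_hom_def by (metis is_poly_cpoly_of)
qed

lemma pencil_in_FolSpace:
  assumes m: "Suc m = k + j"
  shows "pencil k m j \<tau> \<in> FolSpace k (m + k + 2)"
proof -
  have m': "int m = int k + int j - 1"
    using m by linarith
  have "contract_R k (pencil k m j \<tau>) = cpoly_of 0"
    unfolding pencil_def pencil_coeff_eq contract_R_cpoly_of cpoly_of_inject monomial3_def
    by (simp add: const3_simps power2_eq_square algebra_simps)
  then show ?thesis
    unfolding FolSpace_def pencil_def pencil_coeff_eq
    by (auto intro!: quasi_hom_add quasi_hom_monomial3 simp: m' algebra_simps)
qed

lemma pencil_in_Fol:
  assumes m: "Suc m = k + j"
  shows "pencil k m j \<tau> \<in> Fol k (m + k + 2)"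
proof -
  have "form_coeff 2 (m + 2, 0, 0) (pencil k m j \<tau>) = 1"
    by (simp add: form_coeff_pencil base_coeff_def perturbation_coeff_def)
  then have "pencil k m j \<tau> \<noteq> ((\<lambda>m. 0), (\<lambda>m. 0), (\<lambda>m. 0))"
    by (auto simp: form_coeff_def)
  then show ?thesis
    using pencil_in_FolSpace[OF m] by (simp add: Fol_def)
qed

section \<open>Invariant curves of forms near the pencil\<close>

lemma const2_simps: "const2 (a * b) = const2 a * const2 b" "const2 1 = 1" "const2 (- a) = - const2 a"
  by (auto simp: const2_def one_pCons)

lemma (in valuation_ring) minus_in_V: "x \<in> V \<Longrightarrow> - x \<in> V"
  using subring_set_diff[OF V subring_set_0[OF V]] by fastforce

text \<open>In the chart \<open>x0 = 1\<close> the \<open>dx1 \<and> dx2\<close> component of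
  invariance, divided by \<open>- q\<close>, is the equation excluded by
  \<open>no_darboux_pencil\<close>. Here \<open>z1\<close> and \<open>z2\<close> measure the
  distance from the base form in units of \<open>t\<close>, and \<open>near\<close> makes them
  integral.\<close>

lemma no_invariant_curve_near_pencil:
  fixes V :: "complex set"
  assumes V: "valuation_ring V" and k: "k \<ge> 2" and m: "Suc m = k + j"
    and w: "w \<in> FolSpace k (m + k + 2)"
    and q: "q = form_coeff 2 (m + 2, 0, 0) w" "q \<noteq> 0"
    and t: "t = form_coeff 2 (0, Suc j, 1) w / q" "t \<noteq> 0" "t \<in> valuation_ring.M V"
    and near: "\<And>i s. (form_coeff i s w / q - base_coeff k m i s) / t \<in> V"
  shows "\<not> has_invariant_curve k w"
proof
  interpret valuation_ring V by (rule V)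
  assume "has_invariant_curve k w"
  then obtain p where p: "alg_curve_poly k p" "invariant_curve w p"
    by (auto simp: has_invariant_curve_def)
  then obtain F where F: "p = cpoly_of F"
    by (auto simp: alg_curve_poly_def quasi_hom_def elim!: is_polyE)
  obtain N a b c where qh: "quasi_hom k N p" and abc: "(a, b, c) \<noteq> (0, 0, 0)" "p (a, b, c) \<noteq> 0"
    using p(1) by (auto simp: alg_curve_poly_def)
  define n where "n = a + b + k * c"
  have n: "n \<ge> 1" "N = int n"
  proof -
    show "n \<ge> 1"
    proof (cases "c = 0")
      case False
      then have "k * c > 0" using k by simp
      then show ?thesis unfolding n_def by linarith
    qed (use abc(1) in \<open>auto simp: n_def\<close>)
    show "N = int n"
      using qh abc(2) unfolding n_def quasi_hom_def by (metis qdeg_eq)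
  qed
  have Fn: "quasi_hom k (int n) (cpoly_of F)" "F \<noteq> 0"
    using qh abc by (auto simp: n F)
  obtain A0 A1 A2 where A: "w = (cpoly_of A0, cpoly_of A1, cpoly_of A2)"
    "quasi_hom k (int (m + k + 2) - 1) (cpoly_of A1)"
    "quasi_hom k (int (m + k + 2) - int k) (cpoly_of A2)"
    "X0 * A0 + X1 * A1 + const3 (of_nat k) * (X2 * A2) = 0"
    by (rule FolSpaceE[OF w])
  obtain T where T: "A1 * map_poly dy F - A2 * map_poly dx F = F * T"
    "quasi_hom k (int (m + k + 2) - 1 - int k) (cpoly_of T)"
    "\<And>b c. int (b + k * c) = int (m + k + 2) - 1 - int k \<Longrightarrow>
       coeff2 (coeff T 0) b c = - of_nat n * coeff2 (coeff A2 0) (Suc b) c"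
    by (rule invariant_curve_cofactor[OF A(2-4) Fn p(2)[unfolded A(1) F]]) (rule that)
  define f where "f = poly F 1"
  define \<alpha>1 where "\<alpha>1 = poly A1 1"
  define \<alpha>2 where "\<alpha>2 = poly A2 1"
  define \<theta> where "\<theta> = poly T 1"
  have A1: "quasi_hom k (int (m + k + 1)) (cpoly_of A1)"
    and A2: "quasi_hom k (int (m + 2)) (cpoly_of A2)"
    and Tq: "quasi_hom k (int (m + 1)) (cpoly_of T)"
    using A(2,3) T(2) by (simp_all add: algebra_simps)
  have eq: "\<alpha>1 * dy f - \<alpha>2 * dx f = f * \<theta>"
    using arg_cong[OF T(1), of "\<lambda>P. poly P 1"]
    by (simp add: f_def \<alpha>1_def \<alpha>2_def \<theta>_def poly_map_dx poly_map_dy)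
  define z1 where "z1 = const2 (inverse t) * (const2 (inverse q) * \<alpha>2 - 1)"
  define z2 where "z2 = const2 (inverse t) * (const2 (- inverse q) * \<alpha>1 - (monom (monom 1 1) m + 1))"
  define l where "l = const2 (- inverse q) * \<theta>"
  have coeff2_monom: "coeff2 (monom (monom 1 (Suc 0)) m :: complex poly poly) b c = (if b = m \<and> c = 1 then 1 else 0)" for b c
    by (simp add: coeff2_def coeff_monom)
  have coeff2_1: "coeff2 (1 :: complex poly poly) b c = (if b = 0 \<and> c = 0 then 1 else 0)" for b c
    by (cases b; cases c) (auto simp: coeff2_def coeff_eq_0)
  show False
  proof (rule no_darboux_pencil[of m k n t z1 z2 f l])
    show "m \<ge> 1" "k \<ge> 2" "k \<le> m + 1" "n \<ge> 1" "t \<in> M" "t \<noteq> 0"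
      using m k n t by auto
    show "integral z1"
      unfolding integral_def
    proof (intro allI)
      fix b c
      show "coeff2 z1 b c \<in> V"
      proof (cases "b + k * c \<le> m + 2")
        case True
        have "coeff2 z1 b c = (form_coeff 2 (m + 2 - (b + k * c), b, c) w / q
            - base_coeff k m 2 (m + 2 - (b + k * c), b, c)) / t"
        proof -
          have "base_coeff k m 2 (m + 2 - (b + k * c), b, c) = coeff2 (1 :: complex poly poly) b c"
            using k by (auto simp: base_coeff_def coeff2_1)
          moreover have "coeff2 z1 b c = inverse t *
              (inverse q * coeff2 \<alpha>2 b c - coeff2 (1 :: complex poly poly) b c)"
            by (simp only: z1_def coeff2_const_mult coeff2_diff)
          moreover have "coeff2 \<alpha>2 b c = form_coeff 2 (m + 2 - (b + k * c), b, c) w"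
            using True by (simp add: \<alpha>2_def dehomogenize_coeff[OF A2] form_coeff_def A(1))
          ultimately show ?thesis
            by (simp only:) (simp add: divide_inverse algebra_simps)
        qed
        then show ?thesis using near by simp
      next
        case False
        then have "coeff2 z1 b c = 0"
          by (auto simp: z1_def coeff2_1 \<alpha>2_def dehomogenize_coeff[OF A2])
        then show ?thesis by (simp add: subring_set_0 V)
      qed
    qed
    show "integral z2"
      unfolding integral_def
    proof (intro allI)
      fix b c
      show "coeff2 z2 b c \<in> V"
      proof (cases "b + k * c \<le> m + k + 1")
        case True
        have "coeff2 z2 b c = - ((form_coeff 1 (m + k + 1 - (b + k * c), b, c) w / q
            - base_coeff k m 1 (m + k + 1 - (b + k * c), b, c)) / t)"
        proof -
          have "base_coeff k m 1 (m + k + 1 - (b + k * c), b, c) =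
              - coeff2 (monom (monom 1 1) m + 1 :: complex poly poly) b c"
            using m k by (auto simp: base_coeff_def coeff2_1 coeff2_monom)
          moreover have "coeff2 z2 b c = inverse t *
              (- inverse q * coeff2 \<alpha>1 b c - coeff2 (monom (monom 1 1) m + 1) b c)"
            by (simp only: z2_def coeff2_const_mult coeff2_diff)
          moreover have "coeff2 \<alpha>1 b c = form_coeff 1 (m + k + 1 - (b + k * c), b, c) w"
            using True by (simp add: \<alpha>1_def dehomogenize_coeff[OF A1] form_coeff_def A(1))
          ultimately show ?thesis
            by (simp only:) (simp add: divide_inverse algebra_simps)
        qed
        then show ?thesis using near minus_in_V by simp
      next
        case False
        then have "coeff2 z2 b c = 0"
          using m by (auto simp: z2_def coeff2_1 coeff2_monom \<alpha>1_def dehomogenize_coeff[OF A1])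
        then show ?thesis by (simp add: subring_set_0 V)
      qed
    qed
    show "f \<noteq> 0"
    proof
      assume "f = 0"
      then have "coeff2 (poly F 1) b c = 0" by (simp add: f_def)
      then show False
        using abc by (simp add: dehomogenize_coeff[OF Fn(1)] F n_def)
    qed
    have tt: "const2 t * (const2 (inverse t) * p) = p" for p
      using t(2) by (simp add: mult.assoc[symmetric] const2_simps(1)[symmetric] const2_simps(2))
    have e1: "const2 t * z1 = const2 (inverse q) * \<alpha>2 - 1"
      by (simp only: z1_def tt)
    have e2: "const2 t * z2 = const2 (- inverse q) * \<alpha>1 - (monom (monom 1 1) m + 1)"
      by (simp only: z2_def tt)
    have e3: "const2 t * (z1 * dx f + z2 * dy f) = (const2 t * z1) * dx f + (const2 t * z2) * dy f"
      by (simp only: distrib_left mult.assoc)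
    have "shamsuddin m f + const2 t * (z1 * dx f + z2 * dy f) =
        const2 (- inverse q) * (\<alpha>1 * dy f - \<alpha>2 * dx f)"
      unfolding e3 e1 e2 shamsuddin_def const2_simps(3) by (simp add: algebra_simps)
    then show "shamsuddin m f + const2 t * (z1 * dx f + z2 * dy f) = l * f"
      unfolding eq l_def by (simp only: mult.assoc mult.commute[of f])
    show "b + k * c \<le> m + 1" if "coeff2 l b c \<noteq> 0" for b c
      using that by (auto simp: l_def \<theta>_def dehomogenize_coeff[OF Tq] split: if_splits)
    \<comment> \<open>As \<open>j + k\<close> is the full weight \<open>m + 1\<close> of
      \<open>T\<close>, the term \<open>x^j y\<close> in the chart comes from
      \<open>x1^j x2\<close>, which is free of \<open>x0\<close>.\<close>
    have "coeff2 (coeff T 0) j 1 = - of_nat n * coeff2 (coeff A2 0) (Suc j) 1"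
      using m by (intro T(3)) auto
    moreover have "m + 1 - k = j" "j + k = m + 1"
      using m by auto
    ultimately show "coeff2 l (m + 1 - k) 1 = of_nat n * t"
      using t(1) by (simp add: l_def \<theta>_def dehomogenize_coeff[OF Tq] A(1) form_coeff_def divide_inverse)
  qed
qed

section \<open>Generic foliations\<close>

text \<open>Polynomial expressions with rational coefficients, kept as syntax: their values at a
  form make up a ring, while the expressions themselves are countable and can index the
  union.\<close>

datatype param_expr = Const rat | Param | Coord nat mon
  | Plus param_expr param_expr | Times param_expr param_expr

instance param_expr :: countable
  by countable_datatype

text \<open>\<open>Param\<close> is the parameter \<open>t = T / q\<close>, and the form is \<open>q\<close> times
  \<open>\<omega>\<^sub>0 + t z\<close> with \<open>z\<close> having the coefficients \<open>Coord\<close>.\<close>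

primrec expr_value :: "nat \<Rightarrow> nat \<Rightarrow> nat \<Rightarrow> param_expr \<Rightarrow> form1 \<Rightarrow> complex" where
  "expr_value k m j (Const r) w = of_rat r"
| "expr_value k m j Param w = form_coeff 2 (0, Suc j, 1) w / form_coeff 2 (m + 2, 0, 0) w"
| "expr_value k m j (Coord i s) w =
    (form_coeff i s w - base_coeff k m i s * form_coeff 2 (m + 2, 0, 0) w) / form_coeff 2 (0, Suc j, 1) w"
| "expr_value k m j (Plus E1 E2) w = expr_value k m j E1 w + expr_value k m j E2 w"
| "expr_value k m j (Times E1 E2) w = expr_value k m j E1 w * expr_value k m j E2 w"

lemma poly_fun_power: "f \<in> poly_fun \<Longrightarrow> (\<lambda>w. f w ^ n) \<in> poly_fun"
  by (induction n) (auto intro: pf_const pf_mult)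

lemma poly_fun_diff: "f \<in> poly_fun \<Longrightarrow> g \<in> poly_fun \<Longrightarrow> (\<lambda>w. f w - g w) \<in> poly_fun"
  using pf_add[of f "\<lambda>w. (-1) * g w"] pf_mult[OF pf_const[of "-1"], of g] by simp

lemma form_coeff_smult: "form_coeff i s (form_smult a w) = a * form_coeff i s w"
  by (auto simp: form_coeff_def form_smult_def split: prod.splits)

text \<open>Values of expressions are rational functions, of degree 0 under scaling, with powers of
  \<open>q\<close> and \<open>T\<close> as denominators; hence \<open>(q T)^e\<close> clears them
  and gives degree \<open>2 e\<close>. The identity is confined to nonzero \<open>q\<close> and
  \<open>T\<close>, since division by zero returns 0.\<close>

lemma clear_denominators:
  fixes k m j :: nat
  defines "q \<equiv> form_coeff 2 (m + 2, 0, 0)" and "T \<equiv> form_coeff 2 (0, Suc j, 1)"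
  shows "\<exists>H e. H \<in> poly_fun \<and> (\<forall>a w. H (form_smult a w) = a ^ (2 * e) * H w) \<and>
    (\<forall>w. q w \<noteq> 0 \<longrightarrow> T w \<noteq> 0 \<longrightarrow> H w = (q w * T w) ^ e * expr_value k m j E w)"
proof (induction E)
  case (Const r)
  show ?case
    by (rule exI[of _ "\<lambda>w. of_rat r"], rule exI[of _ 0]) (auto intro: pf_const)
next
  case Param
  show ?case
    by (rule exI[of _ "\<lambda>w. T w * T w"], rule exI[of _ 1])
      (auto intro!: pf_mult pf_coord simp: q_def T_def form_coeff_smult power2_eq_square)
next
  case (Coord i s)
  define H where "H w = (form_coeff i s w - base_coeff k m i s * q w) * q w" for w
  have "H \<in> poly_fun"
    unfolding H_def q_def by (intro pf_mult pf_coord pf_const poly_fun_diff)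
  moreover have "H (form_smult a w) = a ^ (2 * 1) * H w" for a w
    by (simp add: H_def q_def form_coeff_smult power2_eq_square algebra_simps)
  moreover have "H w = (q w * T w) ^ 1 * expr_value k m j (Coord i s) w" if "T w \<noteq> 0" for w
    using that by (simp add: H_def q_def T_def)
  ultimately show ?case by blast
next
  case (Plus E1 E2)
  obtain H1 e1 H2 e2 where H: "H1 \<in> poly_fun" "\<And>a w. H1 (form_smult a w) = a ^ (2 * e1) * H1 w"
    "\<And>w. q w \<noteq> 0 \<Longrightarrow> T w \<noteq> 0 \<Longrightarrow> H1 w = (q w * T w) ^ e1 * expr_value k m j E1 w"
    "H2 \<in> poly_fun" "\<And>a w. H2 (form_smult a w) = a ^ (2 * e2) * H2 w"
    "\<And>w. q w \<noteq> 0 \<Longrightarrow> T w \<noteq> 0 \<Longrightarrow> H2 w = (q w * T w) ^ e2 * expr_value k m j E2 w"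
    using Plus.IH by metis
  define H where "H w = H1 w * (q w * T w) ^ e2 + H2 w * (q w * T w) ^ e1" for w
  have "H \<in> poly_fun"
    unfolding H_def q_def T_def by (intro pf_add pf_mult poly_fun_power pf_coord H)
  moreover have "H (form_smult a w) = a ^ (2 * (e1 + e2)) * H w" for a w
    by (simp add: H_def H(2,5) q_def T_def form_coeff_smult power_mult_distrib power_add power_mult
        power2_eq_square algebra_simps)
  moreover have "H w = (q w * T w) ^ (e1 + e2) * expr_value k m j (Plus E1 E2) w"
    if "q w \<noteq> 0" "T w \<noteq> 0" for w
    by (simp add: H_def H(3,6)[OF that] power_add algebra_simps)
  ultimately show ?case by blast
next
  case (Times E1 E2)
  obtain H1 e1 H2 e2 where H: "H1 \<in> poly_fun" "\<And>a w. H1 (form_smult a w) = a ^ (2 * e1) * H1 w"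
    "\<And>w. q w \<noteq> 0 \<Longrightarrow> T w \<noteq> 0 \<Longrightarrow> H1 w = (q w * T w) ^ e1 * expr_value k m j E1 w"
    "H2 \<in> poly_fun" "\<And>a w. H2 (form_smult a w) = a ^ (2 * e2) * H2 w"
    "\<And>w. q w \<noteq> 0 \<Longrightarrow> T w \<noteq> 0 \<Longrightarrow> H2 w = (q w * T w) ^ e2 * expr_value k m j E2 w"
    using Times.IH by metis
  define H where "H w = H1 w * H2 w" for w
  have "H \<in> poly_fun"
    unfolding H_def by (intro pf_mult H)
  moreover have "H (form_smult a w) = a ^ (2 * (e1 + e2)) * H w" for a w
    by (simp add: H_def H(2,5) power_add algebra_simps)
  moreover have "H w = (q w * T w) ^ (e1 + e2) * expr_value k m j (Times E1 E2) w"
    if "q w \<noteq> 0" "T w \<noteq> 0" for w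
    by (simp add: H_def H(3,6)[OF that] power_add algebra_simps)
  ultimately show ?case by blast
qed

text \<open>On the pencil \<open>q = 1\<close> and \<open>T = \<tau>\<close>, so
  \<open>Param\<close> is \<open>\<tau>\<close> and each \<open>Coord\<close> is a constant. This
  serves to show that no expression inverts \<open>Param\<close> along the whole pencil.\<close>

lemma expr_value_pencil:
  "\<exists>P. \<forall>\<tau>. \<tau> \<noteq> 0 \<longrightarrow> expr_value k m j E (pencil k m j \<tau>) = poly P \<tau>"
proof (induction E)
  case (Const r)
  show ?case by (rule exI[of _ "[:of_rat r:]"]) simp
next
  case Param
  show ?case
    by (rule exI[of _ "[:0, 1:]"])
      (simp add: form_coeff_pencil base_coeff_def perturbation_coeff_def)
next
  case (Coord i s)
  have "expr_value k m j (Coord i s) (pencil k m j \<tau>) = poly [:perturbation_coeff k j i s:] \<tau>"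
    if "\<tau> \<noteq> 0" for \<tau>
  proof -
    have "form_coeff 2 (m + 2, 0, 0) (pencil k m j \<tau>) = 1" "form_coeff 2 (0, Suc j, 1) (pencil k m j \<tau>) = \<tau>"
      by (simp_all add: form_coeff_pencil base_coeff_def perturbation_coeff_def)
    then show ?thesis
      using that by (simp add: form_coeff_pencil)
  qed
  then show ?case by blast
next
  case (Plus E1 E2)
  then show ?case by (metis expr_value.simps(4) poly_add)
next
  case (Times E1 E2)
  then show ?case by (metis expr_value.simps(5) poly_mult)
qed

text \<open>The last hypothesis says that \<open>t\<close> is not invertible in the ring of values,
  so some valuation ring contains that ring with \<open>t\<close> in its maximal ideal. The
  coefficients of \<open>z\<close> are such values, hence integral.\<close>

lemma generic_no_invariant_curve:
  assumes k: "k \<ge> 2" and m: "Suc m = k + j" and w: "w \<in> FolSpace k (m + k + 2)"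
    and q: "form_coeff 2 (m + 2, 0, 0) w \<noteq> 0" and T: "form_coeff 2 (0, Suc j, 1) w \<noteq> 0"
    and generic: "\<And>E. expr_value k m j Param w * expr_value k m j E w \<noteq> 1"
  shows "\<not> has_invariant_curve k w"
proof -
  define t where "t = expr_value k m j Param w"
  have t: "t \<noteq> 0"
    using q T by (simp add: t_def)
  define A where "A = range (\<lambda>E. expr_value k m j E w)"
  have A_I: "expr_value k m j E w \<in> A" for E
    by (simp add: A_def)
  have A: "subring_set A"
    unfolding subring_set_def
  proof (intro conjI ballI)
    show "1 \<in> A"
      using A_I[of "Const 1"] by simp
    fix x y assume "x \<in> A" "y \<in> A"
    then obtain E1 E2 where E: "x = expr_value k m j E1 w" "y = expr_value k m j E2 w"
      by (auto simp: A_def)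
    show "x - y \<in> A"
      using A_I[of "Plus E1 (Times (Const (-1)) E2)"] by (simp add: E)
    show "x * y \<in> A"
      using A_I[of "Times E1 E2"] by (simp add: E)
  qed
  have tA: "t \<in> A"
    unfolding t_def by (rule A_I)
  have t_noninv: "t * a \<noteq> 1" if "a \<in> A" for a
    using that generic by (auto simp: A_def t_def)
  obtain V where vr: "A \<subseteq> V" "subring_set V" "\<And>b. b \<in> V \<Longrightarrow> t * b \<noteq> 1"
    "\<And>z. z \<in> V \<or> inverse z \<in> V"
    by (rule exists_valuation_ring[OF A tA t_noninv]) (assumption, rule that)
  interpret valuation_ring V
  proof
    show "inverse (of_nat n) \<in> V" for n
      using A_I[of "Const (inverse (of_nat n))"] vr(1) by (auto simp: of_rat_inverse)
  qed (use vr in auto)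
  have "t \<in> M"
    using vr(1) vr(3)[of "inverse t"] tA t by (auto simp: M_def)
  moreover have "(form_coeff i s w / form_coeff 2 (m + 2, 0, 0) w - base_coeff k m i s) / t \<in> V" for i s
  proof -
    have "(form_coeff i s w / form_coeff 2 (m + 2, 0, 0) w - base_coeff k m i s) / t =
        expr_value k m j (Coord i s) w"
      using q T by (simp add: t_def field_simps)
    also have "\<dots> \<in> V"
      using A_I vr(1) by blast
    finally show ?thesis .
  qed
  ultimately show ?thesis
    using no_invariant_curve_near_pencil[OF valuation_ring_axioms k m w refl q, of t] t
    by (simp add: t_def)
qed

lemma generic_foliation:
  assumes k: "k \<ge> 2" and m: "Suc m = k + j"
  shows "\<exists>S :: nat \<Rightarrow> (form1 \<Rightarrow> complex) set.
    (\<forall>n. \<forall>f\<in>S n. hom_poly_fun f) \<and>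
    (\<forall>n. zariski_closed_in_Fol k (m + k + 2) (S n) \<noteq> Fol k (m + k + 2)) \<and>
    {w \<in> Fol k (m + k + 2). has_invariant_curve k w} \<subseteq> (\<Union>n. zariski_closed_in_Fol k (m + k + 2) (S n))"
proof -
  define q where "q = form_coeff 2 (m + 2, 0, 0)"
  define T where "T = form_coeff 2 (0, Suc j, 1)"
  \<comment> \<open>This vanishes exactly when \<open>E\<close> is inverse to
    \<open>Param\<close>.\<close>
  define relation where "relation E = Plus (Times Param E) (Const (-1))" for E
  define cleared where "cleared E h e \<longleftrightarrow> h \<in> poly_fun \<and> (\<forall>a w. h (form_smult a w) = a ^ (2 * e) * h w) \<and>
    (\<forall>w. q w \<noteq> 0 \<longrightarrow> T w \<noteq> 0 \<longrightarrow> h w = (q w * T w) ^ e * expr_value k m j (relation E) w)"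
    for E h and e :: nat
  have "\<forall>E. \<exists>h e. cleared E h e"
    unfolding cleared_def q_def T_def by (intro allI clear_denominators)
  then obtain H where "\<forall>E. \<exists>e. cleared E (H E) e"
    by (rule choice[THEN exE])
  then obtain e where "\<forall>E. cleared E (H E) (e E)"
    by (rule choice[THEN exE])
  then have H: "H E \<in> poly_fun" "H E (form_smult a w) = a ^ (2 * e E) * H E w"
    "q w \<noteq> 0 \<Longrightarrow> T w \<noteq> 0 \<Longrightarrow> H E w = (q w * T w) ^ e E * expr_value k m j (relation E) w" for E a w
    unfolding cleared_def by blast+
  \<comment> \<open>The factor \<open>q T\<close> also puts the forms at which the coordinates are
    undefined into the exceptional set.\<close>
  define f where "f E w = q w * T w * H E w" for E w
  define S where "S n = {f (from_nat n)}" for n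
  have "hom_poly_fun (f E)" for E
    unfolding hom_poly_fun_def
  proof
    show "f E \<in> poly_fun"
      unfolding f_def q_def T_def by (intro pf_mult pf_coord H)
    have "f E (form_smult a w) = a ^ (2 * e E + 2) * f E w" for a w
      by (simp add: f_def H(2) q_def T_def form_coeff_smult)
    then show "\<exists>e. \<forall>a w. f E (form_smult a w) = a ^ e * f E w" by blast
  qed
  moreover have "zariski_closed_in_Fol k (m + k + 2) (S n) \<noteq> Fol k (m + k + 2)" for n
  proof -
    define E where "E = (from_nat n :: param_expr)"
    obtain P where P: "\<And>\<tau>. \<tau> \<noteq> 0 \<Longrightarrow> expr_value k m j E (pencil k m j \<tau>) = poly P \<tau>"
      using expr_value_pencil by blast
    \<comment> \<open>\<open>Q(0) = -1\<close>, so \<open>Q\<close> has finitely many roots, and a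
      nonzero \<open>\<tau>\<close> avoiding them gives a member of the pencil outside the closed
      set.\<close>
    define Q where "Q = [:0, 1:] * P - 1"
    have "poly Q 0 \<noteq> 0" by (simp add: Q_def)
    then have "Q \<noteq> 0" by auto
    then have "finite (insert 0 {\<tau>. poly Q \<tau> = 0})"
      by (simp add: poly_roots_finite)
    then obtain \<tau> where \<tau>: "\<tau> \<noteq> 0" "poly Q \<tau> \<noteq> 0"
      using ex_new_if_finite[OF infinite_UNIV_char_0] by blast
    let ?w = "pencil k m j \<tau>"
    have qT: "q ?w = 1" "T ?w = \<tau>"
      by (simp_all add: q_def T_def form_coeff_pencil base_coeff_def perturbation_coeff_def)
    have "expr_value k m j (relation E) ?w = poly Q \<tau>"
      using P[OF \<tau>(1)]
      by (simp add: relation_def Q_def form_coeff_pencil base_coeff_def perturbation_coeff_def)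
    then have "f E ?w \<noteq> 0"
      using qT \<tau> by (simp add: f_def H(3))
    then show ?thesis
      using pencil_in_Fol[OF m, of \<tau>] by (auto simp: zariski_closed_in_Fol_def S_def E_def)
  qed
  moreover have "{w \<in> Fol k (m + k + 2). has_invariant_curve k w}
      \<subseteq> (\<Union>n. zariski_closed_in_Fol k (m + k + 2) (S n))"
  proof
    fix w assume "w \<in> {w \<in> Fol k (m + k + 2). has_invariant_curve k w}"
    then have w: "w \<in> Fol k (m + k + 2)" "has_invariant_curve k w" by auto
    have "\<exists>E. f E w = 0"
    proof (rule ccontr)
      assume *: "\<nexists>E. f E w = 0"
      then have qT: "q w \<noteq> 0" "T w \<noteq> 0" by (auto simp: f_def)
      have "expr_value k m j (relation E) w \<noteq> 0" for E
        using * H(3)[OF qT, of E] by (auto simp: f_def)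
      then have "expr_value k m j Param w * expr_value k m j E w \<noteq> 1" for E
        by (simp add: relation_def)
      then show False
        using generic_no_invariant_curve[OF k m] w qT by (auto simp: Fol_def q_def T_def)
    qed
    then obtain E where "f E w = 0" ..
    then have "w \<in> zariski_closed_in_Fol k (m + k + 2) (S (to_nat E))"
      using w by (simp add: zariski_closed_in_Fol_def S_def)
    then show "w \<in> (\<Union>n. zariski_closed_in_Fol k (m + k + 2) (S n))" by blast
  qed
  ultimately show ?thesis
    by (intro exI[of _ S]) (simp add: S_def)
qed

theorem theoremB:
  fixes k d :: nat
  assumes "k \<ge> 2"
  shows "(d \<ge> 2 * k + 1 \<longrightarrow>
           (\<exists>S :: nat \<Rightarrow> (form1 \<Rightarrow> complex) set.
              (\<forall>n. \<forall>f\<in>S n. hom_poly_fun f) \<and>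
              (\<forall>n. zariski_closed_in_Fol k d (S n) \<noteq> Fol k d) \<and>
              {w \<in> Fol k d. has_invariant_curve k w} \<subseteq> (\<Union>n. zariski_closed_in_Fol k d (S n))))
       \<and> (d < 2 * k + 1 \<longrightarrow> (\<forall>w \<in> Fol k d. has_invariant_curve k w))"
proof (intro conjI impI)
  assume d: "d \<ge> 2 * k + 1"
  define m where "m = d - k - 2"
  \<comment> \<open>By \<open>d \<ge> 2k + 1\<close> this subtraction is not truncated, and
    \<open>x1^(j+1) x2\<close> has the weight \<open>d - k\<close> required in
    \<open>A2\<close>.\<close>
  define j where "j = d - 2 * k - 1"
  have "Suc m = k + j" "d = m + k + 2"
    using d assms by (auto simp: m_def j_def)
  then show "\<exists>S :: nat \<Rightarrow> (form1 \<Rightarrow> complex) set.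
      (\<forall>n. \<forall>f\<in>S n. hom_poly_fun f) \<and>
      (\<forall>n. zariski_closed_in_Fol k d (S n) \<noteq> Fol k d) \<and>
      {w \<in> Fol k d. has_invariant_curve k w} \<subseteq> (\<Union>n. zariski_closed_in_Fol k d (S n))"
    using generic_foliation[OF assms] by blast
next
  assume "d < 2 * k + 1"
  then show "\<forall>w\<in>Fol k d. has_invariant_curve k w"
    using invariant_curve_small_degree[OF assms] by (auto simp: Fol_def)
qed

end
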